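(* Let $A\in\mathbb{R}_+^{n\times n}$ be irreducible and let $b\in\mathbb{R}_+^n$ be such that $\operatorname{rank}([b\ Ab\ \dots\ A^{n-1}b])=n$. Let $S\in\mathbb{R}^{n\times n}$ be nonsingular with $A=S\,\mathrm{diag}(A_1,A_2)\,S^{-1}$, where $A_1\in\mathbb{R}$ equals $\rho(A)$ and $A_2\in\mathbb{R}^{(n-1)\times(n-1)}$ has $\mathrm{spec}(A_2)=\mathrm{spec}(A)\setminus\{\rho(A)\}$. Then the following statements are equivalent: (a) The finite controllable subset $\mathrm{Conset}_{\mathrm f}(A,b)$ is polyhedral, and hence there exists an integer $k^*\in\mathbb{Z}_+$, $k^*\ge k_{\mathrm{vert}}$, such that $\mathrm{Conset}_{\mathrm f}(A,b)=\mathrm{Conset}_{k^*}(A,b)$. (b) $A$ has a nonnegative recursion. (c) $A_2$ does not have any positive (real) eigenvalue.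
   Context: $\mathbb{R}_+=[0,\infty)$, $\mathbb{Z}_+=\{1,2,\dots\}$; $\mathrm{spec}$ is the set of eigenvalues and $\rho$ the spectral radius. A cone is polyhedral if it is the set of all nonnegative linear combinations of finitely many vectors. A matrix $A\in\mathbb{R}_+^{n\times n}$ is reducible if for some permutation matrix $P$, $P^TAP=\begin{bmatrix} A_{11} & 0 \\ A_{21} & A_{22} \end{bmatrix}$ with square nonempty diagonal blocks; otherwise it is irreducible (a $1\times1$ matrix is regarded as irreducible exactly when its entry is strictly positive). By Perron–Frobenius, $\rho(A)$ is a simple eigenvalue of such an $A$, so the decomposition into $A_1,A_2$ exists. A real square matrix $B$ has a nonnegative recursion if there exist $m\in\mathbb{N}$ and $c_0,\dots,c_{m-1}\ge0$ with $B^m=\sum_{i=0}^{m-1}c_iB^i$. For the system $x(t+1)=Ax(t)+bu(t)$, $x(0)=0$, with scalar inputs $u(t)\ge0$: $\mathrm{Conset}_k(A,b)=\{\sum_{i=1}^{k}A^{i-1}b\,u(k-i):u(0),\dots,u(k-1)\ge0\}$ for $k\in\mathbb{Z}_+$, and $\mathrm{Conset}_{\mathrm f}(A,b)=\bigcup_{k\ge1}\mathrm{Conset}_k(A,b)$. When $\mathrm{Conset}_{\mathrm f}(A,b)$ is polyhedral, its vertex number $k_{\mathrm{vert}}$ is the smallest $k\in\mathbb{Z}_+$ with $A^{k}b\in\mathrm{Conset}_{k}(A,b)$ (such a $k$ then exists). *)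

theory Defs
  imports
    "HOL-Combinatorics.Permutations"
    "Jordan_Normal_Form.DL_Rank"
    "Jordan_Normal_Form.Spectral_Radius"
begin

definition nonneg_mat :: "real mat \<Rightarrow> bool" where
  "nonneg_mat A \<longleftrightarrow> (\<forall>i<dim_row A. \<forall>j<dim_col A. A $$ (i, j) \<ge> 0)"

definition nonneg_vec :: "real vec \<Rightarrow> bool" where
  "nonneg_vec v \<longleftrightarrow> (\<forall>i<dim_vec v. v $ i \<ge> 0)"

definition permutation_mat :: "nat \<Rightarrow> real mat \<Rightarrow> bool" where
  "permutation_mat n P \<longleftrightarrow>
     (\<exists>p. p permutes {0..<n} \<and> P = mat n n (\<lambda>(i, j). if i = p j then 1 else 0))"

definition reducible_mat :: "real mat \<Rightarrow> bool" where
  "reducible_mat A \<longleftrightarrow>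
     (let n = dim_row A in
      \<exists>P r A11 A21 A22.
        permutation_mat n P \<and> 0 < r \<and> r < n \<and>
        A11 \<in> carrier_mat r r \<and> A21 \<in> carrier_mat (n - r) r \<and>
        A22 \<in> carrier_mat (n - r) (n - r) \<and>
        transpose_mat P * A * P = four_block_mat A11 (0\<^sub>m r (n - r)) A21 A22)"

(* A 1 x 1 matrix has no block partition, so it is never reducible in the above sense;
   by convention it is irreducible exactly when its entry is positive. *)
definition irreducible_mat :: "real mat \<Rightarrow> bool" where
  "irreducible_mat A \<longleftrightarrow>
     (if dim_row A = 1 then A $$ (0, 0) > 0 else \<not> reducible_mat A)"

abbreviation complex_mat :: "real mat \<Rightarrow> complex mat" where
  "complex_mat A \<equiv> map_mat complex_of_real A"

definition nonneg_recursion :: "real mat \<Rightarrow> bool" where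
  "nonneg_recursion B \<longleftrightarrow>
     (\<exists>m. \<exists>c :: nat \<Rightarrow> real. (\<forall>i<m. c i \<ge> 0) \<and>
        B ^\<^sub>m m = finsum (ring_mat TYPE(real) (dim_row B) ()) (\<lambda>i. c i \<cdot>\<^sub>m (B ^\<^sub>m i)) {0..<m})"

definition polyhedral_cone :: "nat \<Rightarrow> real vec set \<Rightarrow> bool" where
  "polyhedral_cone n C \<longleftrightarrow>
     (\<exists>V. finite V \<and> V \<subseteq> carrier_vec n \<and>
        C = {finsum_vec TYPE(real) n (\<lambda>v. c v \<cdot>\<^sub>v v) V | c. \<forall>v\<in>V. c v \<ge> 0})"

definition krylov_mat :: "real mat \<Rightarrow> real vec \<Rightarrow> real mat" where
  "krylov_mat A b =
     mat_of_cols (dim_vec b) (map (\<lambda>i. (A ^\<^sub>m i) *\<^sub>v b) [0..<dim_vec b])"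

definition conset :: "nat \<Rightarrow> real mat \<Rightarrow> real vec \<Rightarrow> real vec set" where
  "conset k A b =
     {finsum_vec TYPE(real) (dim_vec b) (\<lambda>i. u (k - i) \<cdot>\<^sub>v ((A ^\<^sub>m (i - 1)) *\<^sub>v b)) {1..k} | u.
        \<forall>t<k. u t \<ge> 0}"

definition conset_fin :: "real mat \<Rightarrow> real vec \<Rightarrow> real vec set" where
  "conset_fin A b = (\<Union>k\<in>{1..}. conset k A b)"

(* Only meaningful when some such k exists, which is the case whenever
   conset_fin A b is polyhedral. *)
definition vertex_number :: "real mat \<Rightarrow> real vec \<Rightarrow> nat" where
  "vertex_number A b = (LEAST k. k \<ge> 1 \<and> (A ^\<^sub>m k) *\<^sub>v b \<in> conset k A b)"

end

theory Submission
  imports Defs "HOL-Library.Nonpos_Ints"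
begin

text \<open>
  The hard implication is from (c) to (b). Controllability makes the monic annihilating polynomial
  \<open>p\<close> of \<open>A\<close> of degree \<open>n\<close> minimal, so that its roots are exactly the eigenvalues and
  \<open>\<rho>\<close> is a simple root. By Wielandt's argument every eigenvalue \<open>z \<rho>\<close> with \<open>|z| = 1\<close> makes
  \<open>A\<close> diagonally similar to \<open>z A\<close>; by minimality of \<open>p\<close> this forces \<open>z ^ (n - k) = 1\<close> whenever the
  coefficient of \<open>x ^ k\<close> in \<open>p\<close> is nonzero. Hence \<open>p = x ^ a * P (x ^ g)\<close>, where \<open>s = \<rho> ^ g\<close> is
  the only root of \<open>P\<close> of modulus at least \<open>s\<close> and the only positive one. Write
  \<open>P = y ^ k * (y - s) * R\<close>. A root \<open>c\<close> of \<open>R\<close> has a power with nonpositive real part, so it is a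
  root of a polynomial \<open>y ^ (2 * k) - 2 * Re (c ^ k) * y ^ k + |c| ^ (2 * k)\<close> with nonnegative
  coefficients, whence \<open>R\<close> divides some \<open>Q\<close> with nonnegative, and initially positive, coefficients. Modulo
  \<open>(y - s) * R\<close>, the powers \<open>y ^ m\<close> equal \<open>s ^ m * Q / Q s\<close> plus a remainder of order
  \<open>\<theta> ^ m\<close> with \<open>\<theta> < s\<close>, and so become nonnegative combinations of lower powers.
\<close>

subsection \<open>Polynomials with a dominant positive root\<close>

text \<open>The equivalence of (a) and (b) rests on \<open>b\<close> being a cyclic vector: a matrix
  that commutes with \<open>A\<close> and kills \<open>b\<close> is zero, so a relation among the
  vectors \<open>A^k b\<close> is already one among the powers of \<open>A\<close>. From (b) to (c),
  divide \<open>t^m = sum c_k t^k\<close> by \<open>t^m\<close>: the right side becomes zero or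
  strictly decreasing on \<open>t > 0\<close>, so it takes the value 1 at most once, and \<rho>
  already uses this up. The obstacle from (c) to (b) is that \<rho> need not dominate: further
  eigenvalues of modulus \<rho> would keep the rescaled remainders of \<open>x^m\<close> modulo
  \<open>p\<close> oscillating, with no nonnegative limit to hold on to. Passing to
  \<open>y = x^g\<close> removes this, because all peripheral eigenvalues have the same
  \<open>g\<close>-th power \<open>s\<close>. The factor \<open>x^a * y^k\<close> collects the
  eigenvalue 0 and only shifts exponents. Simplicity of \<rho> is read off the given decomposition,
  where the spectrum of \<open>A2\<close> omits \<rho>. The minimal polynomial is taken over the
  complex numbers so that remainders can be estimated one root at a time.\<close>

text \<open>
  The recursion for the quotients \<open>q m\<close> of \<open>monom 1 m\<close> by \<open>e\<close> is what makes the induction work: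
  for one more factor \<open>x - a\<close>, the new correction is \<open>t m = poly (q m) a\<close>, which satisfies a stable
  scalar recursion.
\<close>
lemma linear_factors_power_remainder_decay:
  fixes as :: "complex list" and th :: real
  assumes "\<And>a. a \<in> set as \<Longrightarrow> cmod a < th" and "0 < th"
  defines "e \<equiv> (\<Prod>a\<leftarrow>as. [:-a, 1:])"
  shows "\<exists>q t C. \<forall>m. q (Suc m) = pCons (t m) (q m) \<and> cmod (t m) \<le> C * th ^ m \<and>
    degree (monom 1 m - e * q m) \<le> degree e \<and>
    (\<forall>i. cmod (coeff (monom 1 m - e * q m) i) \<le> C * th ^ m)"
  using assms(1) unfolding e_def
proof (induction as)
  case Nil
  show ?case
    by (rule exI[of _ "\<lambda>m. monom 1 m"], rule exI[of _ "\<lambda>m. 0"], rule exI[of _ 0])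
       (simp add: monom_Suc)
next
  case (Cons a as)
  define e where "e = (\<Prod>a\<leftarrow>as. [:-a, 1:])"
  have "\<And>a. a \<in> set as \<Longrightarrow> cmod a < th" using Cons.prems by simp
  from Cons.IH[OF this] obtain q t C where
    q: "\<And>m. q (Suc m) = pCons (t m) (q m)" and t: "\<And>m. cmod (t m) \<le> C * th ^ m"
    and d: "\<And>m. degree (monom 1 m - e * q m) \<le> degree e"
    and c: "\<And>m i. cmod (coeff (monom 1 m - e * q m) i) \<le> C * th ^ m"
    unfolding e_def by blast
  have ath: "cmod a < th" using Cons.prems by simp
  define s where "s m = poly (q m) a" for m
  have s_Suc: "s (Suc m) = t m + a * s m" for m by (simp add: s_def q)
  \<comment> \<open>Either the start value or the fixed point of
    \<open>D * th = C + cmod a * D\<close>, the worst case of \<open>s_Suc\<close> rescaled by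
    \<open>th ^ m\<close>. This is where \<open>cmod a < th\<close> is spent.\<close>
  define D where "D = max (cmod (s 0)) (C / (th - cmod a))"
  have D0: "0 \<le> D" by (simp add: D_def le_max_iff_disj)
  have "C \<le> D * (th - cmod a)"
    using ath by (simp add: D_def pos_divide_le_eq[symmetric])
  then have CD: "C + cmod a * D \<le> D * th" by (simp add: algebra_simps)
  have s: "cmod (s m) \<le> D * th ^ m" for m
  proof (induction m)
    case 0
    show ?case by (simp add: D_def)
  next
    case (Suc m)
    have "cmod (s (Suc m)) \<le> cmod (t m) + cmod a * cmod (s m)"
      unfolding s_Suc using norm_triangle_ineq[of "t m" "a * s m"] by (simp add: norm_mult)
    also have "\<dots> \<le> C * th ^ m + cmod a * (D * th ^ m)"
      by (intro add_mono t mult_left_mono Suc) auto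
    also have "\<dots> = (C + cmod a * D) * th ^ m" by (simp add: algebra_simps)
    also have "\<dots> \<le> (D * th) * th ^ m" using CD \<open>0 < th\<close> by (intro mult_right_mono) auto
    finally show ?case by (simp add: mult_ac)
  qed
  define K where "K = (\<Sum>i\<le>degree e. cmod (coeff e i))"
  have K: "cmod (coeff e i) \<le> K" for i
  proof (cases "i \<le> degree e")
    case True
    then show ?thesis unfolding K_def by (intro member_le_sum) auto
  next
    case False
    then show ?thesis by (simp add: coeff_eq_0 K_def sum_nonneg)
  qed
  have K0: "0 \<le> K" by (simp add: K_def sum_nonneg)
  \<comment> \<open>Dividing the old quotient by \<open>x - a\<close> leaves the constant
    \<open>s m\<close>, so the new remainder is the old one plus \<open>s m\<close> times
    \<open>e\<close>. Horner's scheme turns the \<open>pCons\<close> recursion of \<open>q\<close>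
    into the one of \<open>q'\<close>, with \<open>s m\<close> as the new correction.\<close>
  define q' where "q' m = synthetic_div (q m) a" for m
  have r: "monom 1 m - ([:-a, 1:] * e) * q' m = (monom 1 m - e * q m) + smult (s m) e" for m
  proof -
    have "q m = [:-a, 1:] * q' m + [:s m:]"
      unfolding q'_def s_def by (rule synthetic_div_correct'[symmetric])
    moreover have "e * [:s m:] = smult (s m) e" by simp
    ultimately have "e * q m = ([:-a, 1:] * e) * q' m + smult (s m) e"
      by (simp only: distrib_left mult.assoc mult.left_commute)
    then show ?thesis by (simp only: diff_diff_eq2[symmetric] add_diff_cancel_right diff_add_eq_diff_diff_swap) simp
  qed
  have "e \<noteq> 0" unfolding e_def by (auto simp: prod_list_zero_iff)
  then have de: "degree ([:-a, 1:] * e) = Suc (degree e)" by (subst degree_mult_eq) auto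
  have C0: "0 \<le> C" using order_trans[OF norm_ge_zero t[of 0]] by simp
  show ?case
  proof (rule exI[of _ q'], rule exI[of _ s], rule exI[of _ "C + D * K + D"], intro allI conjI)
    fix m
    show "q' (Suc m) = pCons (s m) (q' m)" by (simp add: q'_def q s_def)
    have "0 \<le> C * th ^ m" "0 \<le> D * K * th ^ m" using C0 D0 K0 \<open>0 < th\<close> by auto
    then show "cmod (s m) \<le> (C + D * K + D) * th ^ m" using s[of m] by (simp add: algebra_simps)
    have e_eq: "(\<Prod>a\<leftarrow>a # as. [:- a, 1:]) = [:-a, 1:] * e" by (simp add: e_def)
    show "degree (monom 1 m - (\<Prod>a\<leftarrow>a # as. [:- a, 1:]) * q' m) \<le> degree (\<Prod>a\<leftarrow>a # as. [:- a, 1:])"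
      unfolding e_eq r de
      by (rule order_trans[OF degree_add_le_max]) (use d[of m] degree_smult_le[of "s m" e] in auto)
    fix i
    have "cmod (coeff (monom 1 m - e * q m + smult (s m) e) i)
        \<le> cmod (coeff (monom 1 m - e * q m) i) + cmod (s m) * cmod (coeff e i)"
      using norm_triangle_ineq[of "coeff (monom 1 m - e * q m) i" "s m * coeff e i"]
      by (simp add: norm_mult)
    also have "\<dots> \<le> C * th ^ m + D * th ^ m * K"
      using D0 \<open>0 < th\<close> by (intro add_mono c mult_mono s K) auto
    also have "\<dots> \<le> (C + D * K + D) * th ^ m" using D0 \<open>0 < th\<close> by (simp add: algebra_simps)
    finally show "cmod (coeff (monom 1 m - (\<Prod>a\<leftarrow>a # as. [:- a, 1:]) * q' m) i)
        \<le> (C + D * K + D) * th ^ m"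
      unfolding e_eq r .
  qed
qed

text \<open>The first multiple of \<open>\<bar>Arg z\<bar>\<close> that reaches pi/2 cannot pass pi:
  if the angle is below pi/2, a single step is too short for that, and otherwise the angle itself is
  the multiple. The exponent \<open>k\<close> is its index, hence the ceiling.\<close>

lemma ex_power_Re_nonpos:
  fixes z :: complex
  assumes "z \<notin> \<real>\<^sub>\<ge>\<^sub>0"
  shows "\<exists>k>0. Re (z ^ k) \<le> 0"
proof -
  have z: "z \<noteq> 0" using assms by auto
  define \<theta> where "\<theta> = \<bar>Arg z\<bar>"
  have zr: "z = rcis (cmod z) (Arg z)" by (simp add: rcis_cmod_Arg)
  have Arg: "- pi < Arg z" "Arg z \<le> pi" using Arg_bounded[of z] by auto
  have "Arg z \<noteq> 0"
  proof
    assume "Arg z = 0"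
    with zr have "z = of_real (cmod z)" by (simp add: rcis_def)
    with assms show False by (metis nonneg_Reals_of_real_iff norm_ge_zero)
  qed
  then have \<theta>: "0 < \<theta>" "\<theta> \<le> pi" using Arg by (auto simp: \<theta>_def)
  define k where "k = nat \<lceil>(pi / 2) / \<theta>\<rceil>"
  have pos: "0 < (pi / 2) / \<theta>" using \<theta> by simp
  have k0: "k > 0" using pos by (simp add: k_def)
  have kreal: "real k = of_int \<lceil>(pi / 2) / \<theta>\<rceil>" using pos by (simp add: k_def)
  have "(pi / 2) / \<theta> \<le> k" unfolding kreal by (rule le_of_int_ceiling)
  then have lo: "pi / 2 \<le> k * \<theta>" using \<theta> by (simp add: field_simps)
  have hi: "k * \<theta> \<le> pi"
  proof (cases "\<theta> \<ge> pi / 2")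
    case True
    then have "(pi / 2) / \<theta> \<le> 1" using \<theta> by (simp add: field_simps)
    then have "k \<le> 1" by (simp add: k_def ceiling_le_iff)
    then have "k = 1" using k0 by simp
    then show ?thesis using \<theta> by simp
  next
    case False
    have "real k < (pi / 2) / \<theta> + 1" unfolding kreal by linarith
    then have "k * \<theta> < pi / 2 + \<theta>" using \<theta> by (simp add: field_simps)
    then show ?thesis using False by simp
  qed
  have "cos (k * Arg z) = cos \<bar>k * Arg z\<bar>" by (simp only: cos_abs_real)
  also have "\<bar>k * Arg z\<bar> = k * \<theta>" by (simp add: \<theta>_def abs_mult)
  also have "cos (k * \<theta>) \<le> cos (pi / 2)" by (rule cos_monotone_0_pi_le) (use lo hi in auto)
  finally have "cos (k * Arg z) \<le> 0" by simp
  moreover have "Re (z ^ k) = cmod z ^ k * cos (k * Arg z)"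
    by (subst zr) (simp add: DeMoivre2)
  ultimately have "Re (z ^ k) \<le> 0" by (simp add: mult_nonneg_nonpos)
  then show ?thesis using k0 by blast
qed

text \<open>Each \<open>T\<close> is the product of \<open>y^k - a^k\<close> and
  \<open>y^k - cnj (a^k)\<close>, so it has the root \<open>a\<close> whether or not the conjugate
  occurs in \<open>as\<close>. Its constant term is positive because \<open>a\<close> is not 0; the
  induction preserves this, and it is later spread over all low coefficients.\<close>

lemma linear_factors_dvd_nonneg_poly:
  fixes as :: "complex list"
  assumes "\<And>a. a \<in> set as \<Longrightarrow> a \<notin> \<real>\<^sub>\<ge>\<^sub>0"
  shows "\<exists>Q :: real poly. (\<forall>i. 0 \<le> coeff Q i) \<and> 0 < coeff Q 0 \<and>
    (\<Prod>a\<leftarrow>as. [:-a, 1:]) dvd map_poly complex_of_real Q"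
  using assms
proof (induction as)
  case Nil
  show ?case by (rule exI[of _ 1]) simp
next
  case (Cons a as)
  then obtain Q :: "real poly" where Q: "\<And>i. 0 \<le> coeff Q i" "0 < coeff Q 0"
    "(\<Prod>a\<leftarrow>as. [:-a, 1:]) dvd map_poly complex_of_real Q"
    by (metis list.set_intros(2))
  have a: "a \<notin> \<real>\<^sub>\<ge>\<^sub>0" using Cons.prems by simp
  then have a0: "a \<noteq> 0" by auto
  obtain k where k: "k > 0" "Re (a ^ k) \<le> 0" using ex_power_Re_nonpos[OF a] by blast
  define T :: "real poly" where
    "T = monom 1 (2 * k) - monom (2 * Re (a ^ k)) k + [:(cmod (a ^ k))\<^sup>2:]"
  have T: "0 \<le> coeff T i" for i using k by (auto simp: T_def coeff_pCons split: nat.splits)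
  have T0: "0 < coeff T 0" using k a0 by (simp add: T_def)
  have Tc: "map_poly complex_of_real T =
      monom 1 (2 * k) - monom (of_real (2 * Re (a ^ k))) k + [:of_real ((cmod (a ^ k))\<^sup>2):]"
    by (rule poly_eqI) (auto simp: T_def coeff_map_poly coeff_pCons split: nat.splits)
  have "poly (map_poly complex_of_real T) a = (a ^ k)\<^sup>2 - 2 * of_real (Re (a ^ k)) * a ^ k + of_real ((cmod (a ^ k))\<^sup>2)"
    unfolding Tc by (simp add: poly_monom power_mult mult.commute power_even_eq)
  also have "\<dots> = 0"
    by (simp add: complex_eq_iff cmod_power2[unfolded power2_eq_square] power2_eq_square algebra_simps)
  finally have "[:-a, 1:] dvd map_poly complex_of_real T" by (simp add: poly_eq_0_iff_dvd)
  then have "(\<Prod>a\<leftarrow>a # as. [:-a, 1:]) dvd map_poly complex_of_real T * map_poly complex_of_real Q"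
    using Q(3) by (simp del: mult_pCons_left) (rule mult_dvd_mono)
  moreover have "map_poly complex_of_real T * map_poly complex_of_real Q = map_poly complex_of_real (T * Q)"
  proof -
    interpret map_poly_idom_hom complex_of_real ..
    show ?thesis by (simp add: hom_mult)
  qed
  moreover have "0 \<le> coeff (T * Q) i" for i
    unfolding coeff_mult by (intro sum_nonneg mult_nonneg_nonneg T Q)
  moreover have "0 < coeff (T * Q) 0" using T0 Q(2) by (simp add: coeff_mult)
  ultimately show ?case by (intro exI[of _ "T * Q"]) simp
qed

text \<open>
  No symmetry of \<open>R\<close> under conjugation is assumed, so \<open>f\<close> has complex coefficients; for a real
  matrix, taking real parts at the end suffices.
\<close>
lemma dominant_root_poly_dvd_nonneg_recursion:
  fixes R :: "complex poly" and s :: real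
  assumes "R \<noteq> 0" and "0 < s"
    and roots: "\<And>a. poly R a = 0 \<Longrightarrow> cmod a < s \<and> a \<notin> \<real>\<^sub>\<ge>\<^sub>0"
  shows "\<exists>m f. degree f < m \<and> (\<forall>i. 0 \<le> Re (coeff f i)) \<and>
    [:- of_real s, 1:] * R dvd monom 1 m - f"
proof -
  obtain as where as: "smult (lead_coeff R) (\<Prod>a\<leftarrow>as. [:-a, 1:]) = R"
    using fundamental_theorem_algebra_factorized[of R] by blast
  define e where "e = (\<Prod>a\<leftarrow>as. [:-a, 1:])"
  define N where "N = degree e"
  have Re: "R = smult (lead_coeff R) e" using as by (simp add: e_def)
  have as_roots: "cmod a < s \<and> a \<notin> \<real>\<^sub>\<ge>\<^sub>0" if "a \<in> set as" for a
  proof (rule roots)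
    have "poly e a = 0" unfolding e_def poly_prod_list_zero_iff using that by auto
    then show "poly R a = 0" by (subst Re) simp
  qed
  have lc: "lead_coeff R \<noteq> 0" using \<open>R \<noteq> 0\<close> by simp
  define E where "E = poly e (of_real s)"
  have E0: "E \<noteq> 0"
  proof
    assume "E = 0"
    then have "poly R (of_real s) = 0" by (subst Re) (simp add: E_def)
    from roots[OF this] show False using \<open>0 < s\<close> by simp
  qed
  \<comment> \<open>The 0 keeps \<open>Max\<close> meaningful when there are no roots;
    \<open>th\<close> then lies midway between the largest modulus and \<open>s\<close>.\<close>
  define M where "M = Max (insert 0 (cmod ` set as))"
  have M: "cmod a \<le> M" if "a \<in> set as" for a
    unfolding M_def using that by (intro Max_ge) auto
  have "0 \<le> M" "M < s" unfolding M_def using as_roots \<open>0 < s\<close> by auto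
  define th where "th = (s + M) / 2"
  have th: "0 < th" "th < s" "M < th" using \<open>0 \<le> M\<close> \<open>M < s\<close> \<open>0 < s\<close> by (auto simp: th_def)
  have "cmod a < th" if "a \<in> set as" for a
    using M[OF that] th(3) by linarith
  from linear_factors_power_remainder_decay[OF this th(1), of as, folded e_def]
  obtain q C where
    deg_r: "\<And>m. degree (monom 1 m - e * q m) \<le> N" and
    coeff_r: "\<And>m i. cmod (coeff (monom 1 m - e * q m) i) \<le> C * th ^ m"
    unfolding N_def by blast
  define r where "r m = monom 1 m - e * q m" for m
  obtain Q0 :: "real poly" where Q0: "\<And>i. 0 \<le> coeff Q0 i" "0 < coeff Q0 0"
    "e dvd map_poly complex_of_real Q0"
    using linear_factors_dvd_nonneg_poly[of as] as_roots unfolding e_def by blast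
  \<comment> \<open>Of \<open>Q0\<close> only the constant term is known to be positive. The factor
    \<open>1 + x + ... + x^N\<close> lifts all coefficients up to index \<open>N\<close> to at least
    \<open>coeff Q0 0\<close>; these are the ones that the remainder disturbs.\<close>
  define U :: "real poly" where "U = (\<Sum>i\<le>N. monom 1 i)"
  have U: "coeff U i = (if i \<le> N then 1 else 0)" for i
    by (simp add: U_def coeff_sum)
  define Q where "Q = Q0 * U"
  have Q: "0 \<le> coeff Q i" for i
    unfolding Q_def coeff_mult by (intro sum_nonneg mult_nonneg_nonneg Q0) (simp add: U)
  have QN: "coeff Q0 0 \<le> coeff Q i" if "i \<le> N" for i
  proof -
    have "coeff Q0 0 = (\<Sum>j\<in>{0}. coeff Q0 j * coeff U (i - j))" using that by (simp add: U)
    also have "\<dots> \<le> coeff Q i" unfolding Q_def coeff_mult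
      by (intro sum_mono2 mult_nonneg_nonneg Q0) (auto simp: U)
    finally show ?thesis .
  qed
  interpret rp: map_poly_idom_hom complex_of_real ..
  define Qc where "Qc = map_poly complex_of_real Q"
  have eQ: "e dvd Qc" unfolding Qc_def Q_def rp.hom_mult using Q0(3) by (rule dvd_mult2)
  define qs where "qs = poly Q s"
  have "coeff Q0 0 * s ^ 0 \<le> (\<Sum>i\<le>degree Q. coeff Q i * s ^ i)"
  proof -
    have "coeff Q0 0 * s ^ 0 \<le> coeff Q 0 * s ^ 0" using QN[of 0] by simp
    also have "\<dots> \<le> (\<Sum>i\<le>degree Q. coeff Q i * s ^ i)"
      by (rule member_le_sum[of 0 _ "\<lambda>i. coeff Q i * s ^ i"]) (use Q \<open>0 < s\<close> in auto)
    finally show ?thesis .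
  qed
  then have qs: "0 < qs" using Q0(2) by (simp add: qs_def poly_altdef)
  have Qcs: "poly Qc (of_real s) = of_real qs" by (simp add: Qc_def qs_def)
  define K where "K = (\<Sum>i\<le>N. cmod (coeff e i))"
  have K: "cmod (coeff e i) \<le> K" if "i \<le> N" for i
    unfolding K_def using that by (intro member_le_sum) auto
  \<comment> \<open>Still congruent to \<open>monom 1 m\<close> modulo \<open>e\<close>, but
    corrected by a multiple of \<open>e\<close> so as to vanish at \<open>s\<close>. Hence
    \<open>s^m / qs * Q + \<delta> m\<close> agrees with \<open>monom 1 m\<close> both modulo
    \<open>e\<close> and at \<open>s\<close>, while the coefficients of \<open>\<delta> m\<close>
    remain of order \<open>th^m\<close>.\<close>
  define \<delta> where "\<delta> m = r m - smult (poly (r m) (of_real s) / E) e" for m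
  have deg_\<delta>: "degree (\<delta> m) \<le> N" for m
    unfolding \<delta>_def by (intro degree_diff_le) (use deg_r[of m] in \<open>auto simp: r_def N_def\<close>)
  define W where "W = (\<Sum>i\<le>N. s ^ i)"
  define C' where "C' = C + C * W / cmod E * K"
  have coeff_\<delta>: "cmod (coeff (\<delta> m) i) \<le> C' * th ^ m" if "i \<le> N" for m i
  proof -
    have "poly (r m) (of_real s) = (\<Sum>i\<le>N. coeff (r m) i * of_real s ^ i)"
      unfolding poly_altdef using deg_r[of m]
      by (intro sum.mono_neutral_left) (auto simp: r_def[symmetric] coeff_eq_0)
    then have "cmod (poly (r m) (of_real s)) \<le> (\<Sum>i\<le>N. cmod (coeff (r m) i * of_real s ^ i))"
      by (simp add: norm_sum)
    also have "\<dots> \<le> (\<Sum>i\<le>N. C * th ^ m * s ^ i)"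
      using \<open>0 < s\<close> coeff_r[of m, folded r_def]
      by (intro sum_mono) (auto simp: norm_mult norm_power intro!: mult_right_mono)
    finally have "cmod (poly (r m) (of_real s)) \<le> C * th ^ m * W" by (simp add: W_def sum_distrib_left)
    moreover from this have "0 \<le> C * th ^ m * W" by (rule order_trans[OF norm_ge_zero])
    ultimately have "cmod (poly (r m) (of_real s)) / cmod E * cmod (coeff e i) \<le> C * th ^ m * W / cmod E * K"
      using K[OF that] by (intro mult_mono divide_right_mono) auto
    moreover have "cmod (coeff (\<delta> m) i) \<le> cmod (coeff (r m) i) + cmod (poly (r m) (of_real s)) / cmod E * cmod (coeff e i)"
      using norm_triangle_ineq4[of "coeff (r m) i" "poly (r m) (of_real s) / E * coeff e i"]
      by (simp add: \<delta>_def norm_mult norm_divide)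
    moreover have "cmod (coeff (r m) i) \<le> C * th ^ m" using coeff_r[of m i] by (simp add: r_def)
    ultimately show ?thesis by (simp add: C'_def field_simps)
  qed
  have "(\<lambda>m. C' * (th / s) ^ m) \<longlonglongrightarrow> C' * 0"
    by (intro tendsto_mult_left LIMSEQ_realpow_zero) (use th \<open>0 < s\<close> in auto)
  moreover have "0 < coeff Q0 0 / qs" using qs Q0(2) by simp
  ultimately have "\<forall>\<^sub>F m in sequentially. C' * (th / s) ^ m < coeff Q0 0 / qs"
    by (simp add: order_tendstoD(2))
  then obtain m0 where m0: "\<And>m. m \<ge> m0 \<Longrightarrow> C' * (th / s) ^ m < coeff Q0 0 / qs"
    unfolding eventually_sequentially by blast
  \<comment> \<open>From \<open>m0\<close> on the main term, of order \<open>s^m\<close>, outweighs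
    \<open>C' * th^m\<close>; the other two bounds keep the degree of \<open>f\<close> below
    \<open>m\<close>.\<close>
  define m where "m = Suc (max m0 (max (degree Q) N))"
  have mm: "C' * th ^ m < s ^ m / qs * coeff Q0 0"
  proof -
    have "C' * (th / s) ^ m < coeff Q0 0 / qs" by (rule m0) (simp add: m_def)
    then show ?thesis using \<open>0 < s\<close> qs by (simp add: power_divide field_simps)
  qed
  define f where "f = smult (of_real (s ^ m / qs)) Qc + \<delta> m"
  have "degree (smult (of_real (s ^ m / qs)) Qc) \<le> degree Q"
    by (rule order_trans[OF degree_smult_le]) (simp add: Qc_def)
  then have "degree f \<le> max (degree Q) N"
    unfolding f_def using deg_\<delta>[of m] by (intro degree_add_le) auto
  then have deg_f: "degree f < m" by (simp add: m_def)
  have f: "0 \<le> Re (coeff f i)" for i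
  proof (cases "i \<le> N")
    case True
    have "Re (coeff f i) = s ^ m / qs * coeff Q i + Re (coeff (\<delta> m) i)"
      by (simp add: f_def Qc_def del: of_real_divide of_real_power)
    moreover have "s ^ m / qs * coeff Q0 0 \<le> s ^ m / qs * coeff Q i"
      using QN[OF True] \<open>0 < s\<close> qs by (intro mult_left_mono) auto
    moreover have "- Re (coeff (\<delta> m) i) \<le> C' * th ^ m"
      using coeff_\<delta>[OF True, of m] abs_Re_le_cmod[of "coeff (\<delta> m) i"] by linarith
    ultimately show ?thesis using mm by linarith
  next
    case False
    then have "coeff (\<delta> m) i = 0" using deg_\<delta>[of m] by (intro coeff_eq_0) auto
    then have "Re (coeff f i) = s ^ m / qs * coeff Q i"
      by (simp add: f_def Qc_def del: of_real_divide of_real_power)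
    then show ?thesis using Q \<open>0 < s\<close> qs by simp
  qed
  have eq: "monom 1 m - f = e * q m + smult (poly (r m) (of_real s) / E) e - smult (of_real (s ^ m / qs)) Qc"
    by (simp add: f_def \<delta>_def r_def)
  have "e dvd monom 1 m - f"
    unfolding eq by (intro dvd_diff dvd_add dvd_smult eQ) auto
  then obtain w where w: "monom 1 m - f = e * w" by (elim dvdE)
  have "poly (monom 1 m - f) (of_real s) = 0"
    using E0 qs by (simp add: f_def \<delta>_def Qcs poly_monom E_def[symmetric])
  then have "poly w (of_real s) = 0" unfolding w using E0 by (simp add: E_def)
  then have "[:- of_real s, 1:] dvd w" by (simp add: poly_eq_0_iff_dvd)
  then have "e * [:- of_real s, 1:] dvd monom 1 m - f" unfolding w by (intro mult_dvd_mono) auto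
  then have "smult (lead_coeff R) (e * [:- of_real s, 1:]) dvd monom 1 m - f" using lc by (rule smult_dvd)
  moreover have "smult c e * L = smult c (e * L)" for c :: complex and L by simp
  ultimately have "[:- of_real s, 1:] * R dvd monom 1 m - f"
    unfolding mult.commute[of _ R] using Re by metis
  then show ?thesis using deg_f f by blast
qed

subsection \<open>Polynomials in a matrix and Krylov matrices\<close>

text \<open>Entrywise, because matrices of arbitrary dimension form no additive monoid as a type,
  whereas \<open>sum\<close> applies to their entries.\<close>

definition poly_mat :: "'a :: comm_ring_1 mat \<Rightarrow> 'a poly \<Rightarrow> 'a mat" where
  "poly_mat B p = mat (dim_row B) (dim_row B)
     (\<lambda>(i, j). \<Sum>k\<le>degree p. coeff p k * (B ^\<^sub>m k) $$ (i, j))"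

lemma poly_mat_carrier [simp]: "B \<in> carrier_mat n n \<Longrightarrow> poly_mat B p \<in> carrier_mat n n"
  by (simp add: poly_mat_def)

lemma dim_poly_mat [simp]: "dim_row (poly_mat B p) = dim_row B" "dim_col (poly_mat B p) = dim_row B"
  by (simp_all add: poly_mat_def)

lemma index_poly_mat:
  assumes "B \<in> carrier_mat n n" "i < n" "j < n" "degree p \<le> d"
  shows "poly_mat B p $$ (i, j) = (\<Sum>k\<le>d. coeff p k * (B ^\<^sub>m k) $$ (i, j))"
proof -
  have "(\<Sum>k\<le>degree p. coeff p k * (B ^\<^sub>m k) $$ (i, j)) = (\<Sum>k\<le>d. coeff p k * (B ^\<^sub>m k) $$ (i, j))"
    using assms(4) by (intro sum.mono_neutral_left) (auto simp: coeff_eq_0)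
  then show ?thesis using assms by (simp add: poly_mat_def)
qed

lemma poly_mat_add:
  assumes B: "B \<in> carrier_mat n n"
  shows "poly_mat B (p + q) = poly_mat B p + poly_mat B q"
proof (rule eq_matI)
  fix i j assume "i < dim_row (poly_mat B p + poly_mat B q)" "j < dim_col (poly_mat B p + poly_mat B q)"
  then have ij: "i < n" "j < n" using B by (auto simp: poly_mat_def)
  define d where "d = max (degree p) (degree q)"
  have "degree (p + q) \<le> d" by (simp add: d_def degree_add_le_max)
  moreover have "degree p \<le> d" "degree q \<le> d" by (auto simp: d_def)
  ultimately show "poly_mat B (p + q) $$ (i, j) = (poly_mat B p + poly_mat B q) $$ (i, j)"
    using ij B by (simp add: index_poly_mat[OF B ij, of _ d] sum.distrib distrib_right)
qed (use B in \<open>auto simp: poly_mat_def\<close>)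

lemma poly_mat_smult:
  assumes B: "B \<in> carrier_mat n n"
  shows "poly_mat B (smult c p) = c \<cdot>\<^sub>m poly_mat B p"
proof (rule eq_matI)
  fix i j assume "i < dim_row (c \<cdot>\<^sub>m poly_mat B p)" "j < dim_col (c \<cdot>\<^sub>m poly_mat B p)"
  then have ij: "i < n" "j < n" using B by (auto simp: poly_mat_def)
  have "degree (smult c p) \<le> degree p" by (rule degree_smult_le)
  with ij B show "poly_mat B (smult c p) $$ (i, j) = (c \<cdot>\<^sub>m poly_mat B p) $$ (i, j)"
    by (simp add: index_poly_mat[OF B ij, of _ "degree p"] sum_distrib_left mult.assoc)
qed (use B in \<open>auto simp: poly_mat_def\<close>)

lemma poly_mat_0: "B \<in> carrier_mat n n \<Longrightarrow> poly_mat B 0 = 0\<^sub>m n n"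
  by (auto simp: poly_mat_def)

lemma mult_mat_vec_index_sum:
  fixes M :: "'a :: comm_semiring_0 mat"
  assumes "M \<in> carrier_mat m n" "v \<in> carrier_vec n" "i < m"
  shows "(M *\<^sub>v v) $ i = (\<Sum>j<n. M $$ (i, j) * v $ j)"
  using assms by (auto simp: scalar_prod_def atLeast0LessThan)

lemma pow_mat_Suc_left:
  assumes B: "B \<in> carrier_mat n n"
  shows "B ^\<^sub>m Suc k = B * B ^\<^sub>m k"
proof (induction k)
  case 0
  show ?case using B by simp
next
  case (Suc k)
  have "B ^\<^sub>m Suc (Suc k) = (B * B ^\<^sub>m k) * B" using Suc by simp
  also have "\<dots> = B * (B ^\<^sub>m k * B)"
    using B pow_carrier_mat[OF B, of k] by (intro assoc_mult_mat)
  finally show ?case by simp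
qed

text \<open>Horner's rule, which opens products and the action on eigenvectors to structural
  induction over polynomials.\<close>

lemma poly_mat_pCons:
  assumes B: "B \<in> carrier_mat n n"
  shows "poly_mat B (pCons a p) = a \<cdot>\<^sub>m 1\<^sub>m n + B * poly_mat B p"
proof (rule eq_matI)
  fix i j assume "i < dim_row (a \<cdot>\<^sub>m 1\<^sub>m n + B * poly_mat B p)" "j < dim_col (a \<cdot>\<^sub>m 1\<^sub>m n + B * poly_mat B p)"
  then have ij: "i < n" "j < n" using B by (auto simp: poly_mat_def)
  have pow: "(B ^\<^sub>m Suc k) $$ (i, j) = (\<Sum>l<n. B $$ (i, l) * (B ^\<^sub>m k) $$ (l, j))" for k
    unfolding pow_mat_Suc_left[OF B] using ij B pow_carrier_mat[OF B, of k]
    by (simp add: scalar_prod_def atLeast0LessThan del: pow_mat.simps)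
  have "degree (pCons a p) \<le> Suc (degree p)" by (rule degree_pCons_le)
  then have "poly_mat B (pCons a p) $$ (i, j)
      = (\<Sum>k\<le>Suc (degree p). coeff (pCons a p) k * (B ^\<^sub>m k) $$ (i, j))"
    by (rule index_poly_mat[OF B ij])
  also have "\<dots> = a * (1\<^sub>m n) $$ (i, j) + (\<Sum>k\<le>degree p. coeff p k * (B ^\<^sub>m Suc k) $$ (i, j))"
    by (subst sum.atMost_Suc_shift) (use B in \<open>simp del: pow_mat.simps(2)\<close>)
  also have "(\<Sum>k\<le>degree p. coeff p k * (B ^\<^sub>m Suc k) $$ (i, j))
      = (\<Sum>l<n. B $$ (i, l) * (\<Sum>k\<le>degree p. coeff p k * (B ^\<^sub>m k) $$ (l, j)))"
    unfolding pow sum_distrib_left by (subst sum.swap) (simp add: mult_ac)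
  also have "\<dots> = (\<Sum>l<n. B $$ (i, l) * poly_mat B p $$ (l, j))"
    using ij by (intro sum.cong refl) (simp add: index_poly_mat[OF B _ _ order_refl])
  also have "\<dots> = (B * poly_mat B p) $$ (i, j)"
    using ij B by (auto simp: scalar_prod_def atLeast0LessThan)
  finally show "poly_mat B (pCons a p) $$ (i, j) = (a \<cdot>\<^sub>m 1\<^sub>m n + B * poly_mat B p) $$ (i, j)"
    using ij B poly_mat_carrier[OF B, of p] by simp
qed (use B in \<open>auto simp: poly_mat_def\<close>)

lemma poly_mat_pCons_0:
  assumes B: "B \<in> carrier_mat n n"
  shows "poly_mat B (pCons 0 p) = B * poly_mat B p"
  unfolding poly_mat_pCons[OF B] using B poly_mat_carrier[OF B, of p] by (intro eq_matI) auto

lemma poly_mat_mult: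
  assumes B: "B \<in> carrier_mat n n"
  shows "poly_mat B (p * q) = poly_mat B p * poly_mat B q"
proof (induction p)
  case 0
  show ?case by (simp add: poly_mat_0[OF B] left_mult_zero_mat[OF poly_mat_carrier[OF B]])
next
  case (pCons a p)
  note c = poly_mat_carrier[OF B]
  have "poly_mat B (pCons a p * q) = poly_mat B (smult a q) + poly_mat B (pCons 0 (p * q))"
    by (simp add: poly_mat_add[OF B])
  also have "poly_mat B (pCons 0 (p * q)) = B * (poly_mat B p * poly_mat B q)"
    by (simp add: poly_mat_pCons_0[OF B] pCons.IH)
  also have "poly_mat B (smult a q) = (a \<cdot>\<^sub>m 1\<^sub>m n) * poly_mat B q"
    by (simp only: poly_mat_smult[OF B] mult_smult_assoc_mat[OF one_carrier_mat c] left_mult_one_mat[OF c])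
  also have "(a \<cdot>\<^sub>m 1\<^sub>m n) * poly_mat B q + B * (poly_mat B p * poly_mat B q)
      = (a \<cdot>\<^sub>m 1\<^sub>m n + B * poly_mat B p) * poly_mat B q"
    using B c[of p] c[of q]
    by (subst add_mult_distrib_mat[of _ n n]) (auto simp: assoc_mult_mat[of _ n n _ n _ n])
  finally show ?case by (simp add: poly_mat_pCons[OF B])
qed

lemma poly_mat_monom:
  assumes B: "B \<in> carrier_mat n n"
  shows "poly_mat B (monom 1 k) = B ^\<^sub>m k"
proof (induction k)
  case 0
  show ?case using B by (auto simp: poly_mat_def)
next
  case (Suc k)
  then show ?case by (simp add: monom_Suc poly_mat_pCons_0[OF B] pow_mat_Suc_left[OF B] del: pow_mat.simps)
qed

lemma poly_mat_X:
  assumes "B \<in> carrier_mat n n"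
  shows "poly_mat B [:0, 1:] = B"
  using poly_mat_monom[OF assms, of 1] assms by (simp add: monom_Suc one_pCons)

lemma poly_mat_linear_factor:
  assumes B: "B \<in> carrier_mat n n"
  shows "poly_mat B ([:- c, 1:] * q) = B * poly_mat B q + (- c) \<cdot>\<^sub>m poly_mat B q"
proof -
  have "[:- c, 1:] * q = pCons 0 q + smult (- c) q" by simp
  then show ?thesis by (simp only: poly_mat_add[OF B] poly_mat_smult[OF B] poly_mat_pCons_0[OF B])
qed

lemma poly_mat_dvd_eq_0:
  assumes B: "B \<in> carrier_mat n n" and "poly_mat B p = 0\<^sub>m n n" "p dvd q"
  shows "poly_mat B q = 0\<^sub>m n n"
proof -
  obtain k where "q = p * k" using assms(3) by (rule dvdE)
  then have "poly_mat B q = 0\<^sub>m n n * poly_mat B k" by (simp only: poly_mat_mult[OF B] assms(2))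
  then show ?thesis by (simp only: left_mult_zero_mat[OF poly_mat_carrier[OF B]])
qed

lemma poly_mat_eigenvector:
  fixes B :: "'a :: field mat"
  assumes B: "B \<in> carrier_mat n n" and v: "v \<in> carrier_vec n" "B *\<^sub>v v = c \<cdot>\<^sub>v v"
  shows "poly_mat B p *\<^sub>v v = poly p c \<cdot>\<^sub>v v"
proof (induction p)
  case 0
  show ?case using v by (auto simp: poly_mat_0[OF B])
next
  case (pCons a p)
  note P = poly_mat_carrier[OF B, of p]
  have "poly_mat B (pCons a p) *\<^sub>v v = (a \<cdot>\<^sub>m 1\<^sub>m n) *\<^sub>v v + B *\<^sub>v (poly_mat B p *\<^sub>v v)"
    using B P v by (simp add: poly_mat_pCons[OF B] add_mult_distrib_mat_vec[of _ n n] assoc_mult_mat_vec[of _ n n _ n])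
  also have "(a \<cdot>\<^sub>m 1\<^sub>m n) *\<^sub>v v = a \<cdot>\<^sub>v v" using v by (intro eq_vecI) (auto simp: scalar_prod_left_unit)
  also have "B *\<^sub>v (poly_mat B p *\<^sub>v v) = poly p c \<cdot>\<^sub>v (c \<cdot>\<^sub>v v)"
    unfolding pCons.IH mult_mat_vec[OF B v(1)] v(2) ..
  finally show ?case using v by (auto simp: algebra_simps)
qed

lemma poly_mat_mult_vec_index:
  assumes B: "B \<in> carrier_mat n n" and b: "b \<in> carrier_vec n" and "i < n" "degree p \<le> d"
  shows "(poly_mat B p *\<^sub>v b) $ i = (\<Sum>k\<le>d. coeff p k * ((B ^\<^sub>m k) *\<^sub>v b) $ i)"
proof -
  have "(poly_mat B p *\<^sub>v b) $ i = (\<Sum>j<n. (\<Sum>k\<le>d. coeff p k * (B ^\<^sub>m k) $$ (i, j)) * b $ j)"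
    unfolding mult_mat_vec_index_sum[OF poly_mat_carrier[OF B] b assms(3)]
    using assms(3) by (intro sum.cong refl) (simp add: index_poly_mat[OF B _ _ assms(4)])
  also have "\<dots> = (\<Sum>k\<le>d. coeff p k * (\<Sum>j<n. (B ^\<^sub>m k) $$ (i, j) * b $ j))"
    unfolding sum_distrib_right sum_distrib_left by (subst sum.swap) (simp add: mult_ac)
  also have "\<dots> = (\<Sum>k\<le>d. coeff p k * ((B ^\<^sub>m k) *\<^sub>v b) $ i)"
    by (simp only: mult_mat_vec_index_sum[OF pow_carrier_mat[OF B] b assms(3)])
  finally show ?thesis .
qed

lemma ex_inverse_if_det_nonzero:
  fixes A :: "'a :: field mat"
  assumes "A \<in> carrier_mat n n" "det A \<noteq> 0"
  shows "\<exists>C \<in> carrier_mat n n. A * C = 1\<^sub>m n \<and> C * A = 1\<^sub>m n"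
  using det_non_zero_imp_unit[OF assms, of "()"] by (auto simp: Units_def ring_mat_def)

text \<open>Counterpart of \<open>krylov_mat\<close> over any commutative ring: the rank hypothesis
  is real, while the minimal polynomial is studied over the complex numbers.\<close>

definition krylov :: "nat \<Rightarrow> 'a :: comm_ring_1 mat \<Rightarrow> 'a vec \<Rightarrow> 'a mat" where
  "krylov n B b = mat n n (\<lambda>(i, k). ((B ^\<^sub>m k) *\<^sub>v b) $ i)"

lemma krylov_carrier [simp]: "krylov n B b \<in> carrier_mat n n"
  by (simp add: krylov_def)

lemma krylov_mult_vec:
  assumes "c \<in> carrier_vec n" "i < n"
  shows "(krylov n B b *\<^sub>v c) $ i = (\<Sum>k<n. c $ k * ((B ^\<^sub>m k) *\<^sub>v b) $ i)"
  using assms by (simp add: krylov_def scalar_prod_def atLeast0LessThan mult.commute)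

text \<open>Along with \<open>b\<close>, the matrix \<open>M\<close> kills every
  \<open>B^k b\<close>, and these are the columns of an invertible matrix. Identities tested on
  \<open>b\<close> alone thereby become matrix identities.\<close>

lemma commuting_mat_eq_0_if_krylov:
  fixes B :: "'a :: field mat"
  assumes B: "B \<in> carrier_mat n n" and b: "b \<in> carrier_vec n" and K: "det (krylov n B b) \<noteq> 0"
    and M: "M \<in> carrier_mat n n" and comm: "M * B = B * M" and Mb: "M *\<^sub>v b = 0\<^sub>v n"
  shows "M = 0\<^sub>m n n"
proof -
  have MBk: "M * B ^\<^sub>m k = B ^\<^sub>m k * M" for k
  proof (induction k)
    case 0
    show ?case using M B by simp
  next
    case (Suc k)
    note P = pow_carrier_mat[OF B, of k]
    have "M * B ^\<^sub>m Suc k = (M * B ^\<^sub>m k) * B" using M B P by (simp add: assoc_mult_mat[of _ n n _ n _ n])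
    also have "\<dots> = B ^\<^sub>m k * (M * B)" using M B P by (simp add: Suc assoc_mult_mat[of _ n n _ n _ n])
    also have "\<dots> = B ^\<^sub>m Suc k * M" using M B P by (simp add: comm assoc_mult_mat[of _ n n _ n _ n])
    finally show ?case .
  qed
  have col: "col (krylov n B b) k = (B ^\<^sub>m k) *\<^sub>v b" if "k < n" for k
    using that pow_carrier_mat[OF B, of k] b by (intro eq_vecI) (auto simp: krylov_def)
  have MK: "M * krylov n B b = 0\<^sub>m n n"
  proof (rule mat_col_eqI)
    fix k assume "k < dim_col (0\<^sub>m n n :: 'a mat)"
    then have k: "k < n" by simp
    note P = pow_carrier_mat[OF B, of k]
    have "col (M * krylov n B b) k = M *\<^sub>v ((B ^\<^sub>m k) *\<^sub>v b)"
      using k M krylov_carrier[of n B b] by (subst col_mult2[of _ n n _ n]) (auto simp: col)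
    also have "\<dots> = (B ^\<^sub>m k) *\<^sub>v (M *\<^sub>v b)"
      unfolding assoc_mult_mat_vec[OF M P b, symmetric] MBk by (rule assoc_mult_mat_vec[OF P M b])
    also have "\<dots> = 0\<^sub>v n" using P unfolding Mb by (intro eq_vecI) (auto simp: mult_mat_vec_index_sum[OF P])
    finally show "col (M * krylov n B b) k = col (0\<^sub>m n n) k" using k by simp
  qed (use M in \<open>auto simp: krylov_def\<close>)
  obtain Ki where Ki: "Ki \<in> carrier_mat n n" "krylov n B b * Ki = 1\<^sub>m n"
    using ex_inverse_if_det_nonzero[OF krylov_carrier K] by blast
  have "M = M * (krylov n B b * Ki)" using M by (simp only: Ki(2) right_mult_one_mat)
  also have "\<dots> = (M * krylov n B b) * Ki" by (rule assoc_mult_mat[OF M krylov_carrier Ki(1), symmetric])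
  also have "\<dots> = 0\<^sub>m n n" by (simp only: MK left_mult_zero_mat[OF Ki(1)])
  finally show ?thesis .
qed

text \<open>The coefficients of \<open>q\<close>, read as a vector, lie in the kernel of the Krylov
  matrix.\<close>

lemma krylov_annihilator_eq_0:
  fixes B :: "'a :: field mat"
  assumes B: "B \<in> carrier_mat n n" and b: "b \<in> carrier_vec n" and K: "det (krylov n B b) \<noteq> 0"
    and q: "poly_mat B q = 0\<^sub>m n n" "degree q < n"
  shows "q = 0"
proof (rule ccontr)
  assume "q \<noteq> 0"
  define c where "c = vec n (coeff q)"
  have c: "c \<in> carrier_vec n" by (simp add: c_def)
  have "krylov n B b *\<^sub>v c = 0\<^sub>v n"
  proof (rule eq_vecI)
    fix i assume "i < dim_vec (0\<^sub>v n :: 'a vec)"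
    then have i: "i < n" by simp
    have "(krylov n B b *\<^sub>v c) $ i = (\<Sum>k\<le>n - 1. coeff q k * ((B ^\<^sub>m k) *\<^sub>v b) $ i)"
      unfolding krylov_mult_vec[OF c i] using q(2) by (intro sum.cong) (auto simp: c_def)
    also have "\<dots> = (poly_mat B q *\<^sub>v b) $ i"
      using q(2) by (subst poly_mat_mult_vec_index[OF B b i]) auto
    also have "\<dots> = 0" using i b by (simp add: q(1))
    finally show "(krylov n B b *\<^sub>v c) $ i = 0\<^sub>v n $ i" using i by simp
  qed (simp add: krylov_def)
  moreover have "c \<noteq> 0\<^sub>v n"
  proof
    assume "c = 0\<^sub>v n"
    then have "c $ degree q = 0" using q(2) by simp
    then show False using q(2) \<open>q \<noteq> 0\<close> by (simp add: c_def)
  qed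
  ultimately show False using K det_0_iff_vec_prod_zero_field[OF krylov_carrier] c by blast
qed

text \<open>Expanding \<open>B^n b\<close> in the Krylov columns gives a monic polynomial that kills
  \<open>b\<close>, and so the whole matrix. By the preceding degree bound it is the minimal
  polynomial.\<close>

lemma ex_krylov_annihilator:
  fixes B :: "'a :: field mat"
  assumes B: "B \<in> carrier_mat n n" and b: "b \<in> carrier_vec n" and K: "det (krylov n B b) \<noteq> 0"
  shows "\<exists>p. lead_coeff p = 1 \<and> degree p = n \<and> poly_mat B p = 0\<^sub>m n n"
proof -
  obtain Ki where Ki: "Ki \<in> carrier_mat n n" "krylov n B b * Ki = 1\<^sub>m n"
    using ex_inverse_if_det_nonzero[OF krylov_carrier K] by blast
  define w where "w = (B ^\<^sub>m n) *\<^sub>v b"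
  have w: "w \<in> carrier_vec n" unfolding w_def using pow_carrier_mat[OF B, of n] b by simp
  define c where "c = Ki *\<^sub>v w"
  have c: "c \<in> carrier_vec n" using Ki w by (simp add: c_def)
  have Kc: "krylov n B b *\<^sub>v c = w"
    unfolding c_def assoc_mult_mat_vec[OF krylov_carrier Ki(1) w, symmetric] Ki(2) using w by simp
  define p where "p = monom 1 n - (\<Sum>k<n. monom (c $ k) k)"
  have coeff_p: "coeff p i = (if i = n then 1 else if i < n then - c $ i else 0)" for i
    by (auto simp: p_def coeff_sum)
  have "degree p \<le> n" by (rule degree_le) (simp add: coeff_p)
  moreover have "n \<le> degree p" by (rule le_degree) (simp add: coeff_p)
  ultimately have deg: "degree p = n" by simp
  have "poly_mat B p * B = B * poly_mat B p"
    using poly_mat_mult[OF B, of p "[:0, 1:]"] poly_mat_mult[OF B, of "[:0, 1:]" p]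
    by (simp only: poly_mat_X[OF B] mult.commute)
  moreover have "poly_mat B p *\<^sub>v b = 0\<^sub>v n"
  proof (rule eq_vecI)
    fix i assume "i < dim_vec (0\<^sub>v n :: 'a vec)"
    then have i: "i < n" by simp
    have "(poly_mat B p *\<^sub>v b) $ i = (\<Sum>k\<le>n. coeff p k * ((B ^\<^sub>m k) *\<^sub>v b) $ i)"
      by (rule poly_mat_mult_vec_index[OF B b i]) (simp add: deg)
    also have "\<dots> = w $ i - (\<Sum>k<n. c $ k * ((B ^\<^sub>m k) *\<^sub>v b) $ i)"
      by (simp add: lessThan_Suc_atMost[symmetric] coeff_p w_def sum_negf)
    also have "\<dots> = 0" unfolding krylov_mult_vec[OF c i, symmetric] Kc by simp
    finally show "(poly_mat B p *\<^sub>v b) $ i = 0\<^sub>v n $ i" using i by simp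
  qed (use poly_mat_carrier[OF B, of p] in auto)
  ultimately have "poly_mat B p = 0\<^sub>m n n"
    by (intro commuting_mat_eq_0_if_krylov[OF B b K]) (use B in auto)
  then show ?thesis using deg coeff_p[of n] by auto
qed

text \<open>Write \<open>p = (x - c) q\<close>. By minimality \<open>q(B)\<close> is not zero, and
  its nonzero columns are eigenvectors since \<open>(B - c) q(B) = 0\<close>.\<close>

lemma eigenvalue_if_minimal_annihilator_root:
  fixes B :: "'a :: field mat"
  assumes B: "B \<in> carrier_mat n n" and p: "poly_mat B p = 0\<^sub>m n n" "p \<noteq> 0"
    and min: "\<And>q. poly_mat B q = 0\<^sub>m n n \<Longrightarrow> degree q < degree p \<Longrightarrow> q = 0"
    and root: "poly p c = 0"
  shows "eigenvalue B c"
proof -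
  obtain q where q: "p = [:- c, 1:] * q" using root by (auto simp: poly_eq_0_iff_dvd)
  then have "q \<noteq> 0" using p(2) by auto
  then have "degree p = Suc (degree q)" unfolding q by (subst degree_mult_eq) auto
  then have N: "poly_mat B q \<noteq> 0\<^sub>m n n" using min[of q] \<open>q \<noteq> 0\<close> by auto
  note Nc = poly_mat_carrier[OF B, of q]
  obtain i j where ij: "i < n" "j < n" "poly_mat B q $$ (i, j) \<noteq> 0"
  proof (rule ccontr)
    assume "\<not> thesis"
    with that have "\<And>i j. i < n \<Longrightarrow> j < n \<Longrightarrow> poly_mat B q $$ (i, j) = 0" by blast
    then have "poly_mat B q = 0\<^sub>m n n" using B by (intro eq_matI) auto
    with N show False by simp
  qed
  define v where "v = col (poly_mat B q) j"
  have v: "v \<in> carrier_vec n" using Nc ij by (simp add: v_def)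
  have "v $ i \<noteq> 0" using ij B by (simp add: v_def)
  then have v0: "v \<noteq> 0\<^sub>v n" using ij by auto
  have "B *\<^sub>v v = c \<cdot>\<^sub>v v"
  proof (rule eq_vecI)
    fix k assume "k < dim_vec (c \<cdot>\<^sub>v v)"
    then have k: "k < n" using v by simp
    have "(B * poly_mat B q + (- c) \<cdot>\<^sub>m poly_mat B q) $$ (k, j) = 0"
      using p(1) k ij unfolding q poly_mat_linear_factor[OF B] by simp
    then show "(B *\<^sub>v v) $ k = (c \<cdot>\<^sub>v v) $ k"
      using k ij B Nc v carrier_matD[OF Nc] by (simp add: v_def)
  qed (use B v in auto)
  then show ?thesis unfolding eigenvalue_def eigenvector_def using v v0 B by auto
qed

subsection \<open>Peripheral eigenvalues of irreducible matrices\<close>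

text \<open>Otherwise listing the indices of \<open>Z\<close> first would produce a zero block in
  the upper right corner. In graph terms, no proper nonempty index set is closed under the edges
  given by nonzero entries.\<close>

lemma irreducible_mat_edge:
  assumes A: "A \<in> carrier_mat n n" and irr: "irreducible_mat A"
    and Z: "Z \<subseteq> {0..<n}" "Z \<noteq> {}" "Z \<noteq> {0..<n}"
  shows "\<exists>i\<in>Z. \<exists>j\<in>{0..<n} - Z. A $$ (i, j) \<noteq> 0"
proof (rule ccontr)
  assume contra: "\<not> ?thesis"
  define r where "r = card Z"
  have fin: "finite Z" using Z(1) finite_subset by blast
  have r: "0 < r" "r < n"
    using Z fin psubset_card_mono[of "{0..<n}" Z] by (auto simp: r_def card_gt_0_iff)
  obtain f1 where f1: "bij_betw f1 {0..<r} Z"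
    using ex_bij_betw_nat_finite[OF fin] unfolding r_def by blast
  have "card ({0..<n} - Z) = card {r..<n}" using Z(1) fin by (simp add: card_Diff_subset r_def)
  then obtain f2 where f2: "bij_betw f2 {r..<n} ({0..<n} - Z)"
    using finite_same_card_bij[of "{r..<n}" "{0..<n} - Z"] by auto
  \<comment> \<open>Positions below \<open>r\<close> enumerate \<open>Z\<close>, the remaining ones
    its complement; the identity from \<open>n\<close> on is what \<open>permutes\<close>
    demands.\<close>
  define p where "p i = (if i < r then f1 i else if i < n then f2 i else i)" for i
  have b1: "bij_betw p {0..<r} Z" using f1 by (rule bij_betw_cong[THEN iffD1, rotated]) (simp add: p_def)
  have b2: "bij_betw p {r..<n} ({0..<n} - Z)" using f2 by (rule bij_betw_cong[THEN iffD1, rotated]) (simp add: p_def)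
  have "bij_betw p ({0..<r} \<union> {r..<n}) (Z \<union> ({0..<n} - Z))"
    using b1 b2 by (rule bij_betw_combine) auto
  moreover have "{0..<r} \<union> {r..<n} = {0..<n}" "Z \<union> ({0..<n} - Z) = {0..<n}" using r Z by auto
  ultimately have "bij_betw p {0..<n} {0..<n}" by simp
  then have p: "p permutes {0..<n}" using r(2) by (intro bij_imp_permutes) (auto simp: p_def)
  have pn: "p i < n" if "i < n" for i using permutes_in_image[OF p, of i] that by simp
  define P where "P = mat n n (\<lambda>(i, j). if i = p j then 1 else 0 :: real)"
  have P: "P \<in> carrier_mat n n" by (simp add: P_def)
  have PAP: "(transpose_mat P * A * P) $$ (i, j) = A $$ (p i, p j)" if ij: "i < n" "j < n" for i j
  proof -
    have 1: "(transpose_mat P * A) $$ (i, l) = A $$ (p i, l)" if "l < n" for l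
    proof -
      have "(transpose_mat P * A) $$ (i, l) = (\<Sum>k<n. (if k = p i then 1 else 0) * A $$ (k, l))"
        using ij that A P by (simp add: scalar_prod_def atLeast0LessThan) (simp add: P_def)
      also have "\<dots> = A $$ (p i, l)" using pn[OF ij(1)] by (simp add: if_distrib[of "\<lambda>x. x * _"] cong: if_cong)
      finally show ?thesis .
    qed
    have "(transpose_mat P * A * P) $$ (i, j) = (\<Sum>k<n. A $$ (p i, k) * (if k = p j then 1 else 0))"
      using ij A P 1 by (subst index_mult_mat) (auto simp: scalar_prod_def atLeast0LessThan P_def)
    also have "\<dots> = A $$ (p i, p j)" using pn[OF ij(2)] by (simp add: if_distrib[of "\<lambda>x. _ * x"] cong: if_cong)
    finally show ?thesis .
  qed
  define blk where "blk r0 c0 nr nc = mat nr nc (\<lambda>(i, j). A $$ (p (i + r0), p (j + c0)))" for r0 c0 nr nc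
  have zero: "A $$ (p i, p j) = 0" if "i < r" "r \<le> j" "j < n" for i j
  proof -
    have "p i \<in> Z" using bij_betwE[OF b1] that by auto
    moreover have "p j \<in> {0..<n} - Z" using bij_betwE[OF b2] that by auto
    ultimately show ?thesis using contra by blast
  qed
  define T where "T = transpose_mat P * A * P"
  have T: "T \<in> carrier_mat n n" using P A by (simp add: T_def)
  have "T = four_block_mat (blk 0 0 r r) (0\<^sub>m r (n - r)) (blk r 0 (n - r) r) (blk r r (n - r) (n - r))"
    by (rule eq_matI) (use r T in \<open>auto simp: PAP[folded T_def] blk_def zero\<close>)
  moreover have "permutation_mat n P" unfolding permutation_mat_def using p P_def by blast
  ultimately have "reducible_mat A"
    unfolding reducible_mat_def Let_def carrier_matD(1)[OF A] T_def using r
    by (intro exI[of _ P] exI[of _ r] exI[of _ "blk 0 0 r r"] exI[of _ "blk r 0 (n - r) r"]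
        exI[of _ "blk r r (n - r) (n - r)"]) (auto simp: blk_def)
  \<comment> \<open>This excludes the one-by-one convention, so irreducibility does deny the block
    partition.\<close>
  moreover have "n \<noteq> 1" using r by simp
  ultimately show False using irr A by (simp add: irreducible_mat_def)
qed

lemma irreducible_mat_nonzero_entry:
  assumes A: "A \<in> carrier_mat n n" and irr: "irreducible_mat A" and "n \<ge> 1"
  shows "\<exists>i<n. \<exists>j<n. A $$ (i, j) \<noteq> 0"
proof (cases "n = 1")
  case True
  then have "A $$ (0, 0) > 0" using irr A by (simp add: irreducible_mat_def)
  then show ?thesis using True by (intro exI[of _ 0]) auto
next
  case False
  have "\<exists>i\<in>{0}. \<exists>j\<in>{0..<n} - {0}. A $$ (i, j) \<noteq> 0"
  proof (rule irreducible_mat_edge[OF A irr])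
    have "1 \<in> {0..<n}" using False \<open>n \<ge> 1\<close> by simp
    then show "{0} \<noteq> {0..<n}" by (metis singletonD zero_neq_one)
  qed (use \<open>n \<ge> 1\<close> in auto)
  then show ?thesis using \<open>n \<ge> 1\<close> by force
qed

text \<open>Two rates conflict under iteration. For \<open>\<mu>\<close> strictly between the
  spectral radius and that radius plus \<open>e\<close>, the powers of \<open>A / \<mu>\<close> stay
  bounded, whereas a nonzero \<open>y i\<close> would force growth like \<open>t^k\<close> with
  \<open>t = (\<rho> + e) / \<mu> > 1\<close>.\<close>

lemma superinvariant_growth_eq_0:
  fixes A :: "real mat"
  assumes A: "A \<in> carrier_mat n n" and nn: "\<And>i j. i < n \<Longrightarrow> j < n \<Longrightarrow> 0 \<le> A $$ (i, j)"
    and "n \<ge> 1" and e: "0 < e"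
    and y: "\<And>i. i < n \<Longrightarrow> 0 \<le> y i"
    and grow: "\<And>i. i < n \<Longrightarrow> (spectral_radius (complex_mat A) + e) * y i \<le> (\<Sum>j<n. A $$ (i, j) * y j)"
    and "i < n"
  shows "y i = (0 :: real)"
proof (rule ccontr)
  assume "y i \<noteq> 0"
  define \<rho> where "\<rho> = spectral_radius (complex_mat A)"
  have cA: "complex_mat A \<in> carrier_mat n n" using A by simp
  have n0: "0 < n" using \<open>n \<ge> 1\<close> by simp
  have \<rho>0: "0 \<le> \<rho>" using spectral_radius_mem_max(1)[OF cA n0] unfolding \<rho>_def by auto
  define \<mu> where "\<mu> = \<rho> + e / 2"
  have \<mu>: "0 < \<mu>" "\<rho> < \<mu>" "\<mu> < \<rho> + e" using \<rho>0 e by (auto simp: \<mu>_def)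
  define A' where "A' = (1 / \<mu>) \<cdot>\<^sub>m A"
  have A': "A' \<in> carrier_mat n n" using A by (simp add: A'_def)
  have cA': "complex_mat A' \<in> carrier_mat n n" using A' by simp
  have "spectral_radius (complex_mat A') < 1"
  proof -
    obtain c where c: "c \<in> spectrum (complex_mat A')" "spectral_radius (complex_mat A') = cmod c"
      using spectral_radius_mem_max(1)[OF cA' n0] by auto
    from c(1) obtain v where v: "v \<in> carrier_vec n" "v \<noteq> 0\<^sub>v n" "complex_mat A' *\<^sub>v v = c \<cdot>\<^sub>v v"
      using cA' unfolding spectrum_def eigenvalue_def eigenvector_def by auto
    have "complex_mat A *\<^sub>v v = (of_real \<mu> * c) \<cdot>\<^sub>v v"
    proof (rule eq_vecI)
      fix k assume "k < dim_vec ((of_real \<mu> * c) \<cdot>\<^sub>v v)"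
      then have k: "k < n" using v by simp
      have "c * v $ k = (complex_mat A' *\<^sub>v v) $ k" using v k by simp
      also have "\<dots> = (\<Sum>j<n. complex_mat A' $$ (k, j) * v $ j)"
        by (rule mult_mat_vec_index_sum[OF cA' v(1) k])
      also have "\<dots> = (1 / of_real \<mu>) * (\<Sum>j<n. complex_mat A $$ (k, j) * v $ j)"
        unfolding sum_distrib_left using A k by (intro sum.cong refl) (simp add: A'_def)
      also have "(\<Sum>j<n. complex_mat A $$ (k, j) * v $ j) = (complex_mat A *\<^sub>v v) $ k"
        by (rule mult_mat_vec_index_sum[OF cA v(1) k, symmetric])
      finally show "(complex_mat A *\<^sub>v v) $ k = ((of_real \<mu> * c) \<cdot>\<^sub>v v) $ k"
        using \<mu> k v(1) by (simp add: field_simps)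
    qed (use A v in auto)
    then have "of_real \<mu> * c \<in> spectrum (complex_mat A)"
      using v A unfolding spectrum_def eigenvalue_def eigenvector_def by auto
    then have "cmod (of_real \<mu> * c) \<le> \<rho>"
      unfolding \<rho>_def by (intro spectral_radius_mem_max(2)[OF cA n0]) auto
    then have "\<mu> * cmod c \<le> \<rho>" using \<mu>(1) by (simp add: norm_mult)
    also have "\<dots> < \<mu> * 1" using \<mu> by simp
    finally have "\<mu> * cmod c < \<mu> * 1" .
    then have "cmod c < 1" by (rule mult_less_cancel_left_pos[OF \<mu>(1), THEN iffD1])
    then show ?thesis using c(2) by simp
  qed
  from spectral_radius_jnf_norm_bound_less_1_upper_triangular[OF cA' this]
  obtain C where C: "\<And>k. norm_bound (complex_mat A' ^\<^sub>m k) C" by blast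
  have C': "\<bar>(A' ^\<^sub>m k) $$ (i, j)\<bar> \<le> C" if "i < n" "j < n" for k i j
  proof -
    have "complex_mat A' ^\<^sub>m k = complex_mat (A' ^\<^sub>m k)" by (rule of_real_hom.mat_hom_pow[OF A', symmetric])
    moreover note carrier_matD[OF pow_carrier_mat[OF A', of k]]
    ultimately have "cmod (complex_mat (A' ^\<^sub>m k) $$ (i, j)) \<le> C"
      using C[of k] that unfolding norm_bound_def by simp
    then show ?thesis using that \<open>dim_row (A' ^\<^sub>m k) = n\<close> \<open>dim_col (A' ^\<^sub>m k) = n\<close>
      by (simp del: pow_mat_dim)
  qed
  define t where "t = (\<rho> + e) / \<mu>"
  have t: "1 < t" using \<mu> by (simp add: t_def)
  have step: "t * y i \<le> (\<Sum>j<n. A' $$ (i, j) * y j)" if "i < n" for i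
  proof -
    have "(\<Sum>j<n. A' $$ (i, j) * y j) = (1 / \<mu>) * (\<Sum>j<n. A $$ (i, j) * y j)"
      unfolding sum_distrib_left using A that by (intro sum.cong refl) (simp add: A'_def)
    also have "\<dots> \<ge> (1 / \<mu>) * ((\<rho> + e) * y i)"
      using grow[OF that] \<mu> by (intro mult_left_mono) (auto simp: \<rho>_def)
    finally show ?thesis by (simp add: t_def)
  qed
  have pw: "t ^ k * y i \<le> (\<Sum>j<n. (A' ^\<^sub>m k) $$ (i, j) * y j)" if "i < n" for k i
    using that
  proof (induction k arbitrary: i)
    case 0
    have "(\<Sum>j<n. (A' ^\<^sub>m 0) $$ (i, j) * y j) = (\<Sum>j<n. (if i = j then y j else 0))"
      using 0 A' by (intro sum.cong refl) auto
    then show ?case using 0 by simp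
  next
    case (Suc k)
    have "t ^ Suc k * y i \<le> t ^ k * (\<Sum>l<n. A' $$ (i, l) * y l)"
      using mult_left_mono[OF step[OF Suc.prems], of "t ^ k"] t by (simp add: mult_ac)
    also have "\<dots> = (\<Sum>l<n. A' $$ (i, l) * (t ^ k * y l))" by (simp add: sum_distrib_left mult_ac)
    also have "\<dots> \<le> (\<Sum>l<n. A' $$ (i, l) * (\<Sum>j<n. (A' ^\<^sub>m k) $$ (l, j) * y j))"
      using Suc \<mu> A by (intro sum_mono mult_left_mono) (auto simp: A'_def nn)
    also have "\<dots> = (\<Sum>j<n. (\<Sum>l<n. A' $$ (i, l) * (A' ^\<^sub>m k) $$ (l, j)) * y j)"
      unfolding sum_distrib_left sum_distrib_right by (subst sum.swap) (simp add: mult_ac)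
    also have "\<dots> = (\<Sum>j<n. (A' ^\<^sub>m Suc k) $$ (i, j) * y j)"
      unfolding pow_mat_Suc_left[OF A'] using A' pow_carrier_mat[OF A', of k] Suc.prems
      by (intro sum.cong refl) (auto simp: scalar_prod_def atLeast0LessThan)
    finally show ?case .
  qed
  have bound: "t ^ k * y i \<le> C * (\<Sum>j<n. y j)" for k
  proof -
    have "(\<Sum>j<n. (A' ^\<^sub>m k) $$ (i, j) * y j) \<le> (\<Sum>j<n. C * y j)"
    proof (intro sum_mono mult_right_mono)
      fix j assume "j \<in> {..<n}"
      then show "(A' ^\<^sub>m k) $$ (i, j) \<le> C" using C'[OF \<open>i < n\<close>, of j k] by auto
    qed (use y in auto)
    then show ?thesis using pw[OF \<open>i < n\<close>, of k] by (simp add: sum_distrib_left)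
  qed
  have yi: "0 < y i" using y[OF \<open>i < n\<close>] \<open>y i \<noteq> 0\<close> by simp
  obtain k where "C * (\<Sum>j<n. y j) / y i < t ^ k" using real_arch_pow[OF t] by blast
  then have "C * (\<Sum>j<n. y j) < t ^ k * y i" using yi by (simp add: field_simps)
  then show False using bound[of k] by simp
qed

text \<open>
  If the defect \<open>d y = A y - \<rho> y\<close> is nonnegative and nonzero, replacing \<open>y\<close> by \<open>y + A y\<close> turns it
  into \<open>d y + A (d y)\<close>, which by irreducibility has strictly more positive entries. A positive defect
  contradicts the growth bound.
\<close>
lemma subinvariant_imp_invariant:
  fixes A :: "real mat"
  assumes A: "A \<in> carrier_mat n n" and nn: "\<And>i j. i < n \<Longrightarrow> j < n \<Longrightarrow> 0 \<le> A $$ (i, j)"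
    and irr: "irreducible_mat A" and "n \<ge> 1"
    and y: "\<And>i. i < n \<Longrightarrow> 0 \<le> y i"
    and sub: "\<And>i. i < n \<Longrightarrow> spectral_radius (complex_mat A) * y i \<le> (\<Sum>j<n. A $$ (i, j) * y j)"
    and "i < n"
  shows "(\<Sum>j<n. A $$ (i, j) * y j) = spectral_radius (complex_mat A) * y i"
proof -
  define \<rho> where "\<rho> = spectral_radius (complex_mat A)"
  define d where "d y i = (\<Sum>j<n. A $$ (i, j) * y j) - \<rho> * y i" for y i
  have False if "\<And>i. i < n \<Longrightarrow> 0 \<le> y i" "\<And>i. i < n \<Longrightarrow> 0 \<le> d y i" "i < n" "0 < d y i" for y i
    using that
  proof (induction "card {i. i < n \<and> d y i = 0}" arbitrary: y i rule: less_induct)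
    case less
    define Z where "Z = {i. i < n \<and> d y i = 0}"
    show ?case
    proof (cases "Z = {}")
      case True
      then have pos: "0 < d y k" if "k < n" for k using less.prems(2)[OF that] that by (force simp: Z_def)
      define m where "m = Min (d y ` {..<n})"
      have m: "0 < m" using pos \<open>n \<ge> 1\<close> by (auto simp: m_def lessThan_empty_iff)
      have mle: "m \<le> d y k" if "k < n" for k unfolding m_def using that by (intro Min_le) auto
      define s where "s = (\<Sum>j<n. y j)"
      have s: "0 \<le> s" unfolding s_def using less.prems(1) by (intro sum_nonneg) auto
      \<comment> \<open>Converts the least defect \<open>m\<close> into relative growth: each
        \<open>y k\<close> is at most \<open>s\<close>, so \<open>e * y k\<close> is at most
        \<open>m\<close>. The 1 guards against \<open>s = 0\<close>.\<close>
      define e where "e = m / (s + 1)"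
      have e: "0 < e" using m s by (simp add: e_def)
      have "(\<rho> + e) * y k \<le> (\<Sum>j<n. A $$ (k, j) * y j)" if "k < n" for k
      proof -
        have "y k \<le> s" unfolding s_def using less.prems(1) that by (intro member_le_sum) auto
        then have "e * y k \<le> e * (s + 1)" using e by (intro mult_left_mono) auto
        also have "\<dots> = m" using s by (simp add: e_def)
        also have "\<dots> \<le> d y k" using mle[OF that] .
        finally show ?thesis by (simp add: d_def algebra_simps)
      qed
      then have y0: "y k = 0" if "k < n" for k
        by (intro superinvariant_growth_eq_0[OF A _ \<open>n \<ge> 1\<close> e])
           (use nn less.prems(1) that in \<open>auto simp: \<rho>_def\<close>)
      then have "d y i = 0" using less.prems(3) by (simp add: d_def)
      then show False using less.prems(4) by simp
    next
      case False
      have "i \<notin> Z" using less.prems(4) by (simp add: Z_def)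
      then have "Z \<noteq> {0..<n}" using less.prems(3) by auto
      moreover have "Z \<subseteq> {0..<n}" by (auto simp: Z_def)
      ultimately have "\<exists>i\<in>Z. \<exists>j\<in>{0..<n} - Z. A $$ (i, j) \<noteq> 0"
        using False by (intro irreducible_mat_edge[OF A irr])
      then
      obtain k l where kl: "k \<in> Z" "l < n" "l \<notin> Z" "A $$ (k, l) \<noteq> 0" by auto
      have kn: "k < n" using kl(1) by (simp add: Z_def)
      have dl: "0 < d y l" using kl less.prems(2)[OF kl(2)] by (auto simp: Z_def)
      define F where "F y i = (\<Sum>j<n. A $$ (i, j) * y j)" for y i
      define y' where "y' i = y i + F y i" for i
      have F0: "0 \<le> F z i" if "\<And>j. j < n \<Longrightarrow> 0 \<le> z j" "i < n" for z i
        unfolding F_def using that by (intro sum_nonneg mult_nonneg_nonneg nn) auto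
      \<comment> \<open>The defect is linear in \<open>y\<close> and commutes with
        \<open>A\<close>.\<close>
      have d': "d y' i = d y i + F (d y) i" for i
        by (simp add: d_def y'_def F_def distrib_left right_diff_distrib sum.distrib sum_subtractf
            sum_distrib_left mult_ac)
      have ge: "d y i \<le> d y' i" if "i < n" for i
        unfolding d' using F0[OF less.prems(2) that] by simp
      have "A $$ (k, l) * d y l \<le> F (d y) k"
        unfolding F_def using kl kn less.prems(2)
        by (intro member_le_sum[of l _ "\<lambda>j. A $$ (k, j) * d y j"] mult_nonneg_nonneg nn) auto
      moreover have "0 < A $$ (k, l) * d y l" using dl kl nn[OF kn kl(2)] by simp
      moreover have "d y k = 0" using kl(1) by (simp add: Z_def)
      ultimately have dk: "0 < d y' k" unfolding d' by linarith
      have "{i. i < n \<and> d y' i = 0} \<subset> Z"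
      proof
        show "{i. i < n \<and> d y' i = 0} \<subseteq> Z"
          using ge less.prems(2) by (force simp: Z_def)
        show "{i. i < n \<and> d y' i = 0} \<noteq> Z" using dk kl(1) by auto
      qed
      then have "card {i. i < n \<and> d y' i = 0} < card Z" by (intro psubset_card_mono) (auto simp: Z_def)
      then show False
      proof (rule less.hyps[folded Z_def])
        show "0 \<le> y' i" if "i < n" for i using less.prems(1)[OF that] F0[OF less.prems(1) that] by (simp add: y'_def)
        show "0 \<le> d y' i" if "i < n" for i using less.prems(2)[OF that] ge[OF that] by simp
      qed (use kn dk in auto)
    qed
  qed
  from this[of y i] have "\<not> 0 < d y i" using y sub \<open>i < n\<close> by (auto simp: d_def \<rho>_def)
  moreover have "0 \<le> d y i" using sub[OF \<open>i < n\<close>] by (simp add: d_def \<rho>_def)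
  ultimately show ?thesis by (simp add: d_def \<rho>_def)
qed

text \<open>Where \<open>y\<close> vanishes, the whole nonnegative row sum vanishes, so no edge
  leads from the zero set into the support; irreducibility then leaves the zero set empty.\<close>

lemma invariant_imp_positive:
  fixes A :: "real mat"
  assumes A: "A \<in> carrier_mat n n" and nn: "\<And>i j. i < n \<Longrightarrow> j < n \<Longrightarrow> 0 \<le> A $$ (i, j)"
    and irr: "irreducible_mat A"
    and y: "\<And>i. i < n \<Longrightarrow> 0 \<le> y i" "k < n" "y k \<noteq> 0"
    and inv: "\<And>i. i < n \<Longrightarrow> (\<Sum>j<n. A $$ (i, j) * y j) = \<rho> * y i"
    and "i < n"
  shows "0 < (y i :: real)"
proof (rule ccontr)
  assume "\<not> 0 < y i"
  define Z where "Z = {i. i < n \<and> y i = 0}"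
  have "i \<in> Z" using \<open>\<not> 0 < y i\<close> y(1)[OF \<open>i < n\<close>] \<open>i < n\<close> by (auto simp: Z_def)
  then have "Z \<noteq> {}" by auto
  have "Z \<subseteq> {0..<n}" "Z \<noteq> {0..<n}" using y(2,3) by (auto simp: Z_def set_eq_iff)
  from irreducible_mat_edge[OF A irr this(1) \<open>Z \<noteq> {}\<close> this(2)]
  obtain p q where pq: "p \<in> Z" "q < n" "q \<notin> Z" "A $$ (p, q) \<noteq> 0" by auto
  have pn: "p < n" using pq by (simp add: Z_def)
  have "(\<Sum>j<n. A $$ (p, j) * y j) = 0" using inv[OF pn] pq by (simp add: Z_def)
  then have "A $$ (p, q) * y q = 0"
    using pq(2) nn pn y(1) by (subst (asm) sum_nonneg_eq_0_iff) auto
  then show False using pq by (auto simp: Z_def)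
qed

text \<open>With radius 0 the all-ones vector would be subinvariant, hence invariant, and every row
  sum would be 0.\<close>

lemma irreducible_spectral_radius_pos:
  fixes A :: "real mat"
  assumes A: "A \<in> carrier_mat n n" and nn: "\<And>i j. i < n \<Longrightarrow> j < n \<Longrightarrow> 0 \<le> A $$ (i, j)"
    and irr: "irreducible_mat A" and "n \<ge> 1"
  shows "0 < spectral_radius (complex_mat A)"
proof (rule ccontr)
  assume "\<not> 0 < spectral_radius (complex_mat A)"
  moreover have "0 \<le> spectral_radius (complex_mat A)"
    using spectral_radius_mem_max(1)[of "complex_mat A" n] A \<open>n \<ge> 1\<close> by auto
  ultimately have \<rho>: "spectral_radius (complex_mat A) = 0" by simp
  have 0: "(\<Sum>j<n. A $$ (i, j) * 1) = 0" if "i < n" for i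
    by (subst subinvariant_imp_invariant[OF A nn irr \<open>n \<ge> 1\<close>, of "\<lambda>_. 1"])
       (use that \<rho> nn in \<open>auto intro: sum_nonneg\<close>)
  obtain i j where ij: "i < n" "j < n" "A $$ (i, j) \<noteq> 0"
    using irreducible_mat_nonzero_entry[OF A irr \<open>n \<ge> 1\<close>] by blast
  have "(\<Sum>j<n. A $$ (i, j)) = 0" using 0[OF ij(1)] by simp
  then show False using nn ij by (subst (asm) sum_nonneg_eq_0_iff) auto
qed

text \<open>The triangle inequality makes the moduli of an eigenvector \<open>x\<close>
  subinvariant, hence invariant and positive. It is then an equality in every row, so the nonzero
  terms \<open>A_ij x_j\<close> of a row share one phase. The witness \<open>d\<close> consists of
  the phases of \<open>x\<close>; with \<open>D = diag d\<close> the conclusion reads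
  \<open>A D = z D A\<close>.\<close>

lemma peripheral_eigenvalue_phases:
  fixes A :: "real mat"
  assumes A: "A \<in> carrier_mat n n" and nn: "\<And>i j. i < n \<Longrightarrow> j < n \<Longrightarrow> 0 \<le> A $$ (i, j)"
    and irr: "irreducible_mat A" and "n \<ge> 1"
    and ev: "eigenvalue (complex_mat A) (z * of_real (spectral_radius (complex_mat A)))" and z: "cmod z = 1"
  shows "\<exists>d. (\<forall>i<n. d i \<noteq> 0) \<and> (\<forall>i<n. \<forall>j<n. of_real (A $$ (i, j)) * d j = z * d i * of_real (A $$ (i, j)))"
proof -
  define \<rho> where "\<rho> = spectral_radius (complex_mat A)"
  have \<rho>: "0 < \<rho>" unfolding \<rho>_def by (rule irreducible_spectral_radius_pos[OF A nn irr \<open>n \<ge> 1\<close>])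
  have cA: "complex_mat A \<in> carrier_mat n n" using A by simp
  obtain x where x: "x \<in> carrier_vec n" "x \<noteq> 0\<^sub>v n" "complex_mat A *\<^sub>v x = (z * of_real \<rho>) \<cdot>\<^sub>v x"
    using ev A unfolding eigenvalue_def eigenvector_def \<rho>_def by auto
  have eq: "(\<Sum>j<n. of_real (A $$ (i, j)) * x $ j) = z * of_real \<rho> * x $ i" if "i < n" for i
  proof -
    have "(\<Sum>j<n. of_real (A $$ (i, j)) * x $ j) = (complex_mat A *\<^sub>v x) $ i"
      unfolding mult_mat_vec_index_sum[OF cA x(1) that] using A that by (intro sum.cong) auto
    then show ?thesis using x that by simp
  qed
  define y where "y i = cmod (x $ i)" for i
  have sub: "\<rho> * y i \<le> (\<Sum>j<n. A $$ (i, j) * y j)" if "i < n" for i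
  proof -
    have "\<rho> * y i = cmod (\<Sum>j<n. of_real (A $$ (i, j)) * x $ j)"
      unfolding eq[OF that] using \<rho> z by (simp add: y_def norm_mult)
    also have "\<dots> \<le> (\<Sum>j<n. cmod (of_real (A $$ (i, j)) * x $ j))" by (rule norm_sum)
    also have "\<dots> = (\<Sum>j<n. A $$ (i, j) * y j)"
      using nn that by (intro sum.cong refl) (simp add: y_def norm_mult)
    finally show ?thesis .
  qed
  have inv: "(\<Sum>j<n. A $$ (i, j) * y j) = \<rho> * y i" if "i < n" for i
    unfolding \<rho>_def
    by (rule subinvariant_imp_invariant[OF A nn irr \<open>n \<ge> 1\<close>]) (use that sub in \<open>auto simp: y_def \<rho>_def\<close>)
  obtain k where k: "k < n" "x $ k \<noteq> 0" using x(1,2) by (metis carrier_vecD eq_vecI index_zero_vec)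
  have y: "0 < y i" if "i < n" for i
    by (rule invariant_imp_positive[OF A nn irr _ k(1) _ inv]) (use k that in \<open>auto simp: y_def\<close>)
  define d where "d i = x $ i / of_real (y i)" for i
  have d1: "cmod (d i) = 1" if "i < n" for i using y[OF that] by (auto simp: d_def norm_divide y_def)
  have xd: "x $ i = d i * of_real (y i)" if "i < n" for i using y[OF that] by (simp add: d_def)
  have cnj: "w * cnj w = 1" if "cmod w = 1" for w
    using that complex_norm_square[of w] by simp
  have "of_real (A $$ (i, j)) * d j = z * d i * of_real (A $$ (i, j))" if ij: "i < n" "j < n" for i j
  proof -
    \<comment> \<open>The phase of the \<open>j\<close>-th term relative to \<open>z * d i\<close>,
      the phase of the row sum. The weights \<open>A_il y_l\<close> keep their total when multiplied
      by \<open>Re (w l)\<close>, so \<open>Re (w l) = 1\<close> wherever the weight is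
      positive.\<close>
    define w where "w j = d j * cnj (z * d i)" for j
    have w1: "cmod (w l) = 1" if "l < n" for l
      using d1 that ij z by (simp add: w_def norm_mult)
    have "(\<Sum>l<n. of_real (A $$ (i, l)) * (w l * of_real (y l)))
        = (\<Sum>l<n. of_real (A $$ (i, l)) * x $ l) * cnj (z * d i)"
      unfolding sum_distrib_right by (intro sum.cong refl) (simp add: w_def xd mult_ac)
    also have "\<dots> = (z * cnj z) * (d i * cnj (d i)) * of_real (\<rho> * y i)"
      unfolding eq[OF ij(1)] xd[OF ij(1)] by (simp add: mult_ac)
    also have "\<dots> = of_real (\<rho> * y i)" using cnj[OF z] cnj[OF d1[OF ij(1)]] by simp
    finally have "Re (\<Sum>l<n. of_real (A $$ (i, l)) * (w l * of_real (y l))) = \<rho> * y i" by simp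
    then have "(\<Sum>l<n. A $$ (i, l) * (Re (w l) * y l)) = (\<Sum>l<n. A $$ (i, l) * y l)"
      using inv[OF ij(1)] by simp
    moreover have "(\<Sum>l<n. A $$ (i, l) * y l * (1 - Re (w l)))
        = (\<Sum>l<n. A $$ (i, l) * y l) - (\<Sum>l<n. A $$ (i, l) * (Re (w l) * y l))"
      unfolding sum_subtractf[symmetric] by (intro sum.cong refl) (simp add: algebra_simps)
    ultimately have "(\<Sum>l<n. A $$ (i, l) * y l * (1 - Re (w l))) = 0" by simp
    moreover have "0 \<le> A $$ (i, l) * y l * (1 - Re (w l))" if "l < n" for l
      using nn[OF ij(1) that] y[OF that] complex_Re_le_cmod[of "w l"] w1[OF that] by simp
    ultimately have "A $$ (i, j) * y j * (1 - Re (w j)) = 0"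
      using ij(2) by (subst (asm) sum_nonneg_eq_0_iff) auto
    then consider "A $$ (i, j) = 0" | "Re (w j) = 1" using y[OF ij(2)] by auto
    then show ?thesis
    proof cases
      case 2
      have "(Re (w j))\<^sup>2 + (Im (w j))\<^sup>2 = 1" using w1[OF ij(2)] cmod_power2[of "w j"] by simp
      then have "w j = 1" using 2 by (simp add: complex_eq_iff)
      then have "d j * (cnj (z * d i) * (z * d i)) = z * d i" unfolding w_def mult.assoc[symmetric] by simp
      moreover have "cmod (z * d i) = 1" using z d1[OF ij(1)] by (simp add: norm_mult)
      ultimately have "d j = z * d i" using cnj[of "z * d i"] by (metis mult.commute mult.right_neutral)
      then show ?thesis by simp
    qed simp
  qed
  moreover have "d i \<noteq> 0" if "i < n" for i using d1[OF that] by auto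
  ultimately show ?thesis by blast
qed

lemma phases_pow_mat:
  fixes A :: "real mat"
  assumes A: "A \<in> carrier_mat n n"
    and d: "\<And>i j. i < n \<Longrightarrow> j < n \<Longrightarrow> of_real (A $$ (i, j)) * d j = z * d i * (of_real (A $$ (i, j)) :: complex)"
    and "i < n" "j < n"
  shows "of_real ((A ^\<^sub>m k) $$ (i, j)) * d j = z ^ k * d i * of_real ((A ^\<^sub>m k) $$ (i, j))"
  using assms(3,4)
proof (induction k arbitrary: i)
  case 0
  then show ?case using A by auto
next
  case (Suc k)
  have eq: "(A ^\<^sub>m Suc k) $$ (i, j) = (\<Sum>l<n. A $$ (i, l) * (A ^\<^sub>m k) $$ (l, j))"
    unfolding pow_mat_Suc_left[OF A] using A pow_carrier_mat[OF A, of k] Suc.prems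
    by (auto simp: scalar_prod_def atLeast0LessThan)
  have "of_real ((A ^\<^sub>m Suc k) $$ (i, j)) * d j
      = (\<Sum>l<n. of_real (A $$ (i, l)) * (of_real ((A ^\<^sub>m k) $$ (l, j)) * d j))"
    unfolding eq by (simp add: sum_distrib_right mult.assoc del: pow_mat.simps)
  also have "\<dots> = (\<Sum>l<n. of_real (A $$ (i, l)) * (z ^ k * d l * of_real ((A ^\<^sub>m k) $$ (l, j))))"
    using Suc by (intro sum.cong refl) (simp del: pow_mat.simps)
  also have "\<dots> = (\<Sum>l<n. z ^ k * (of_real (A $$ (i, l)) * d l) * of_real ((A ^\<^sub>m k) $$ (l, j)))"
    by (simp add: mult_ac)
  also have "\<dots> = (\<Sum>l<n. z ^ k * (z * d i * of_real (A $$ (i, l))) * of_real ((A ^\<^sub>m k) $$ (l, j)))"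
    using Suc.prems by (intro sum.cong refl) (simp add: d)
  also have "\<dots> = z ^ Suc k * d i * of_real ((A ^\<^sub>m Suc k) $$ (i, j))"
    unfolding eq by (simp add: sum_distrib_left mult_ac del: pow_mat.simps)
  finally show ?case .
qed

subsection \<open>Controllable cones\<close>

lemma pow_mult_vec_carrier:
  assumes "A \<in> carrier_mat n n" and "b \<in> carrier_vec n"
  shows "(A ^\<^sub>m i) *\<^sub>v b \<in> carrier_vec n"
  using pow_carrier_mat[OF assms(1)] assms(2) by (rule mult_mat_vec_carrier)

lemma index_finsum_ring_mat:
  assumes "finite F" "f \<in> F \<rightarrow> carrier_mat n n" "i < n" "j < n"
  shows "finsum (ring_mat TYPE(real) n ()) f F $$ (i, j) = (\<Sum>x\<in>F. f x $$ (i, j))"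
    and "finsum (ring_mat TYPE(real) n ()) f F \<in> carrier_mat n n"
proof -
  interpret R: ring "ring_mat TYPE(real) n ()" by (rule ring_mat)
  have "finsum (ring_mat TYPE(real) n ()) f F \<in> carrier_mat n n \<and>
      finsum (ring_mat TYPE(real) n ()) f F $$ (i, j) = (\<Sum>x\<in>F. f x $$ (i, j))"
    using assms(1,2)
  proof (induction F)
    case empty
    then show ?case using assms by (simp add: ring_mat_simps)
  next
    case (insert x F)
    then have fx: "f x \<in> carrier_mat n n" and fF: "f \<in> F \<rightarrow> carrier_mat n n" by auto
    have "finsum (ring_mat TYPE(real) n ()) f (insert x F) = f x + finsum (ring_mat TYPE(real) n ()) f F"
      using insert.hyps fx fF by (subst R.finsum_insert) (auto simp: ring_mat_simps)
    moreover from insert.IH[OF fF]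
    have S: "finsum (ring_mat TYPE(real) n ()) f F \<in> carrier_mat n n"
      "finsum (ring_mat TYPE(real) n ()) f F $$ (i, j) = (\<Sum>x\<in>F. f x $$ (i, j))" by auto
    ultimately show ?case using S carrier_matD[OF S(1)] fx assms(3,4) by (simp add: insert.hyps)
  qed
  then show "finsum (ring_mat TYPE(real) n ()) f F $$ (i, j) = (\<Sum>x\<in>F. f x $$ (i, j))"
    and "finsum (ring_mat TYPE(real) n ()) f F \<in> carrier_mat n n" by auto
qed

lemma nonneg_recursion_iff:
  assumes A: "A \<in> carrier_mat n n" and "n \<ge> 1"
  shows "nonneg_recursion A \<longleftrightarrow>
    (\<exists>m c. (\<forall>i<m. 0 \<le> c i) \<and>
      (\<forall>i<n. \<forall>j<n. (A ^\<^sub>m m) $$ (i, j) = (\<Sum>k<m. c k * (A ^\<^sub>m k) $$ (i, j))))"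
proof -
  have "(A ^\<^sub>m m = finsum (ring_mat TYPE(real) n ()) (\<lambda>i. c i \<cdot>\<^sub>m (A ^\<^sub>m i)) {0..<m}) \<longleftrightarrow>
     (\<forall>i<n. \<forall>j<n. (A ^\<^sub>m m) $$ (i, j) = (\<Sum>k<m. c k * (A ^\<^sub>m k) $$ (i, j)))" for m and c :: "nat \<Rightarrow> real"
  proof -
    let ?F = "finsum (ring_mat TYPE(real) n ()) (\<lambda>i. c i \<cdot>\<^sub>m (A ^\<^sub>m i)) {0..<m}"
    have c: "(\<lambda>i. c i \<cdot>\<^sub>m (A ^\<^sub>m i)) \<in> {0..<m} \<rightarrow> carrier_mat n n" using A by auto
    have F: "?F \<in> carrier_mat n n" using index_finsum_ring_mat(2)[OF _ c, of 0 0] \<open>n \<ge> 1\<close> by simp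
    have idx: "?F $$ (i, j) = (\<Sum>k<m. c k * (A ^\<^sub>m k) $$ (i, j))" if "i < n" "j < n" for i j
    proof -
      have "?F $$ (i, j) = (\<Sum>k\<in>{0..<m}. (c k \<cdot>\<^sub>m (A ^\<^sub>m k)) $$ (i, j))"
        by (rule index_finsum_ring_mat(1)[OF _ c that]) simp
      also have "\<dots> = (\<Sum>k<m. c k * (A ^\<^sub>m k) $$ (i, j))"
        unfolding atLeast0LessThan using that A by (intro sum.cong refl) simp
      finally show ?thesis .
    qed
    show ?thesis
    proof
      assume "A ^\<^sub>m m = ?F"
      then show "\<forall>i<n. \<forall>j<n. (A ^\<^sub>m m) $$ (i, j) = (\<Sum>k<m. c k * (A ^\<^sub>m k) $$ (i, j))"
        using idx by simp
    next
      assume *: "\<forall>i<n. \<forall>j<n. (A ^\<^sub>m m) $$ (i, j) = (\<Sum>k<m. c k * (A ^\<^sub>m k) $$ (i, j))"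
      show "A ^\<^sub>m m = ?F"
        using pow_carrier_mat[OF A, of m] F idx * by (intro eq_matI) auto
    qed
  qed
  then show ?thesis unfolding nonneg_recursion_def carrier_matD(1)[OF A] by simp
qed

lemma mem_conset_iff:
  assumes A: "A \<in> carrier_mat n n" and b: "b \<in> carrier_vec n"
  shows "v \<in> conset k A b \<longleftrightarrow> v \<in> carrier_vec n \<and>
    (\<exists>c. (\<forall>i<k. 0 \<le> c i) \<and> (\<forall>j<n. v $ j = (\<Sum>i<k. c i * ((A ^\<^sub>m i) *\<^sub>v b) $ j)))"
proof -
  have X: "(A ^\<^sub>m i) *\<^sub>v b \<in> carrier_vec n" for i by (rule pow_mult_vec_carrier[OF A b])
  let ?S = "\<lambda>u. finsum_vec TYPE(real) n (\<lambda>i. u (k - i) \<cdot>\<^sub>v ((A ^\<^sub>m (i - 1)) *\<^sub>v b)) {1..k}"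
  have S: "?S u \<in> carrier_vec n" for u using X by (intro finsum_vec_closed) auto
  have idx: "?S u $ j = (\<Sum>i<k. u (k - Suc i) * ((A ^\<^sub>m i) *\<^sub>v b) $ j)" if j: "j < n" for u j
  proof -
    have "?S u $ j = (\<Sum>i\<in>{1..k}. (u (k - i) \<cdot>\<^sub>v ((A ^\<^sub>m (i - 1)) *\<^sub>v b)) $ j)"
      using X by (intro index_finsum_vec[OF _ j]) auto
    also have "\<dots> = (\<Sum>i\<in>{1..k}. u (k - i) * ((A ^\<^sub>m (i - 1)) *\<^sub>v b) $ j)"
      using j carrier_vecD[OF X] by (intro sum.cong refl) (simp del: dim_mult_mat_vec)
    finally show ?thesis by (simp add: sum.atLeast1_atMost_eq)
  qed
  show ?thesis
  proof
    assume "v \<in> conset k A b"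
    then obtain u where u: "v = ?S u" "\<forall>t<k. 0 \<le> u t"
      using b unfolding conset_def by auto
    show "v \<in> carrier_vec n \<and> (\<exists>c. (\<forall>i<k. 0 \<le> c i) \<and> (\<forall>j<n. v $ j = (\<Sum>i<k. c i * ((A ^\<^sub>m i) *\<^sub>v b) $ j)))"
      using S u idx by (intro conjI exI[of _ "\<lambda>i. u (k - Suc i)"]) auto
  next
    assume "v \<in> carrier_vec n \<and> (\<exists>c. (\<forall>i<k. 0 \<le> c i) \<and> (\<forall>j<n. v $ j = (\<Sum>i<k. c i * ((A ^\<^sub>m i) *\<^sub>v b) $ j)))"
    then obtain c where v: "v \<in> carrier_vec n" and c: "\<And>i. i < k \<Longrightarrow> 0 \<le> c i"
      "\<And>j. j < n \<Longrightarrow> v $ j = (\<Sum>i<k. c i * ((A ^\<^sub>m i) *\<^sub>v b) $ j)" by blast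
    \<comment> \<open>Time reversal: the input at time \<open>k - Suc i\<close> has been propagated
      \<open>i\<close> times by time \<open>k\<close>.\<close>
    define u where "u t = c (k - Suc t)" for t
    have "v = ?S u"
    proof (rule eq_vecI)
      fix j assume "j < dim_vec (?S u)"
      then have j: "j < n" using S[of u] by simp
      show "v $ j = ?S u $ j"
        unfolding idx[OF j] c(2)[OF j] by (intro sum.cong refl) (simp add: u_def)
    qed (use v S[of u] in auto)
    moreover have "\<forall>t<k. 0 \<le> u t" using c(1) by (simp add: u_def)
    ultimately show "v \<in> conset k A b" using b unfolding conset_def by auto
  qed
qed

lemma polyhedral_cone_iff:
  "polyhedral_cone n C \<longleftrightarrow> (\<exists>V. finite V \<and> V \<subseteq> carrier_vec n \<and>
     C = {v \<in> carrier_vec n. \<exists>c. (\<forall>w\<in>V. 0 \<le> c w) \<and> (\<forall>j<n. v $ j = (\<Sum>w\<in>V. c w * w $ j))})"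
proof -
  have "{finsum_vec TYPE(real) n (\<lambda>v. c v \<cdot>\<^sub>v v) V | c. \<forall>v\<in>V. c v \<ge> 0} =
      {v \<in> carrier_vec n. \<exists>c. (\<forall>w\<in>V. 0 \<le> c w) \<and> (\<forall>j<n. v $ j = (\<Sum>w\<in>V. c w * w $ j))}"
    (is "?L = ?R") if V: "finite V" "V \<subseteq> carrier_vec n" for V
  proof -
    let ?S = "\<lambda>c. finsum_vec TYPE(real) n (\<lambda>v. c v \<cdot>\<^sub>v v) V"
    have S: "?S c \<in> carrier_vec n" for c using V by (intro finsum_vec_closed) auto
    have idx: "?S c $ j = (\<Sum>w\<in>V. c w * w $ j)" if j: "j < n" for c j
    proof -
      have "?S c $ j = (\<Sum>w\<in>V. (c w \<cdot>\<^sub>v w) $ j)"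
        using V by (intro index_finsum_vec[OF _ j]) auto
      also have "\<dots> = (\<Sum>w\<in>V. c w * w $ j)" using V j by (intro sum.cong refl) auto
      finally show ?thesis .
    qed
    show ?thesis
    proof (intro equalityI subsetI)
      fix v assume "v \<in> ?L"
      then show "v \<in> ?R" using S idx by blast
    next
      fix v assume "v \<in> ?R"
      then obtain c where v: "v \<in> carrier_vec n" and c: "\<forall>w\<in>V. 0 \<le> c w" "\<forall>j<n. v $ j = (\<Sum>w\<in>V. c w * w $ j)"
        by blast
      have "v = ?S c" using v S[of c] c(2) idx[of _ c] by (intro eq_vecI) auto
      then show "v \<in> ?L" using c(1) by blast
    qed
  qed
  then show ?thesis unfolding polyhedral_cone_def by (metis (no_types, lifting))
qed

text \<open>Indexed by \<open>I\<close> rather than by a set of vectors, since the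
  \<open>W i\<close>, typically powers of \<open>A\<close> applied to \<open>b\<close>, may
  coincide.\<close>

lemma conset_conic_combination:
  assumes A: "A \<in> carrier_mat n n" and b: "b \<in> carrier_vec n"
    and "finite I" and d: "\<And>i. i \<in> I \<Longrightarrow> 0 \<le> d i" and W: "\<And>i. i \<in> I \<Longrightarrow> W i \<in> conset k A b"
    and v: "v \<in> carrier_vec n" "\<And>j. j < n \<Longrightarrow> v $ j = (\<Sum>i\<in>I. d i * W i $ j)"
  shows "v \<in> conset k A b"
proof -
  have "\<forall>i\<in>I. \<exists>c. (\<forall>l<k. 0 \<le> c l) \<and> (\<forall>j<n. W i $ j = (\<Sum>l<k. c l * ((A ^\<^sub>m l) *\<^sub>v b) $ j))"
    using W unfolding mem_conset_iff[OF A b] by blast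
  then obtain c where c: "\<And>i l. i \<in> I \<Longrightarrow> l < k \<Longrightarrow> 0 \<le> c i l"
    "\<And>i j. i \<in> I \<Longrightarrow> j < n \<Longrightarrow> W i $ j = (\<Sum>l<k. c i l * ((A ^\<^sub>m l) *\<^sub>v b) $ j)"
    by (auto dest!: bchoice)
  have "v $ j = (\<Sum>l<k. (\<Sum>i\<in>I. d i * c i l) * ((A ^\<^sub>m l) *\<^sub>v b) $ j)" if j: "j < n" for j
  proof -
    have "v $ j = (\<Sum>i\<in>I. \<Sum>l<k. d i * c i l * ((A ^\<^sub>m l) *\<^sub>v b) $ j)"
      unfolding v(2)[OF j] using c(2) j by (intro sum.cong refl) (simp add: sum_distrib_left mult.assoc)
    then show ?thesis unfolding sum_distrib_right by (subst sum.swap) simp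
  qed
  moreover have "0 \<le> (\<Sum>i\<in>I. d i * c i l)" if "l < k" for l
    using c(1) d that by (intro sum_nonneg mult_nonneg_nonneg) auto
  ultimately show ?thesis unfolding mem_conset_iff[OF A b] using v(1)
    by (intro conjI exI[of _ "\<lambda>l. \<Sum>i\<in>I. d i * c i l"]) auto
qed

lemma conset_mono:
  assumes A: "A \<in> carrier_mat n n" and b: "b \<in> carrier_vec n" and "k \<le> l"
  shows "conset k A b \<subseteq> conset l A b"
proof
  fix v assume "v \<in> conset k A b"
  then obtain c where v: "v \<in> carrier_vec n" and c: "\<And>i. i < k \<Longrightarrow> 0 \<le> c i"
    "\<And>j. j < n \<Longrightarrow> v $ j = (\<Sum>i<k. c i * ((A ^\<^sub>m i) *\<^sub>v b) $ j)"
    unfolding mem_conset_iff[OF A b] by blast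
  define c' where "c' i = (if i < k then c i else 0)" for i
  have "v $ j = (\<Sum>i<l. c' i * ((A ^\<^sub>m i) *\<^sub>v b) $ j)" if "j < n" for j
    unfolding c(2)[OF that] using \<open>k \<le> l\<close>
    by (intro sum.mono_neutral_cong_left) (auto simp: c'_def)
  then show "v \<in> conset l A b" unfolding mem_conset_iff[OF A b] using v c(1)
    by (intro conjI exI[of _ c']) (auto simp: c'_def)
qed

lemma pow_mult_vec_mem_conset:
  assumes A: "A \<in> carrier_mat n n" and b: "b \<in> carrier_vec n" and "i < k"
  shows "(A ^\<^sub>m i) *\<^sub>v b \<in> conset k A b"
  unfolding mem_conset_iff[OF A b]
proof (intro conjI exI[of _ "\<lambda>l. if l = i then 1 else 0"] allI impI)
  fix j assume "j < n"
  show "((A ^\<^sub>m i) *\<^sub>v b) $ j = (\<Sum>l<k. (if l = i then 1 else 0) * ((A ^\<^sub>m l) *\<^sub>v b) $ j)"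
    using \<open>i < k\<close> by (simp add: if_distrib[of "\<lambda>x. x * _"] cong: if_cong)
qed (use A b pow_mult_vec_carrier[OF A b] in auto)

text \<open>Each of the finitely many generators is reached in finite time, and the reachable sets
  increase with time, so the largest of these times serves all generators.\<close>

lemma conset_fin_eq_conset_if_polyhedral:
  assumes A: "A \<in> carrier_mat n n" and b: "b \<in> carrier_vec n"
    and "polyhedral_cone n (conset_fin A b)"
  shows "\<exists>k\<ge>1. conset_fin A b = conset k A b"
proof -
  obtain V where V: "finite V" "V \<subseteq> carrier_vec n" and eq: "conset_fin A b =
      {v \<in> carrier_vec n. \<exists>c. (\<forall>w\<in>V. 0 \<le> c w) \<and> (\<forall>j<n. v $ j = (\<Sum>w\<in>V. c w * w $ j))}"
    using assms(3) unfolding polyhedral_cone_iff by blast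
  have "w \<in> conset_fin A b" if "w \<in> V" for w
    unfolding eq mem_Collect_eq
  proof (intro conjI exI[of _ "\<lambda>v. if v = w then 1 else 0"] allI impI)
    fix j assume "j < n"
    show "w $ j = (\<Sum>v\<in>V. (if v = w then 1 else 0) * v $ j)"
      using V that by (simp add: if_distrib[of "\<lambda>x. x * _"] cong: if_cong)
  qed (use V that in auto)
  then have "\<forall>w\<in>V. \<exists>k. w \<in> conset k A b" unfolding conset_fin_def by blast
  then obtain K where K: "\<And>w. w \<in> V \<Longrightarrow> w \<in> conset (K w) A b" by metis
  \<comment> \<open>The inserted 1 makes \<open>k\<close> positive even if there is no
    generator.\<close>
  define k where "k = Max (insert 1 (K ` V))"
  have "1 \<le> k" unfolding k_def using V by (intro Max_ge) auto
  have VK: "w \<in> conset k A b" if "w \<in> V" for w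
  proof -
    have "K w \<le> k" unfolding k_def using V that by (intro Max_ge) auto
    then show ?thesis using conset_mono[OF A b] K[OF that] by blast
  qed
  have "v \<in> conset k A b" if "v \<in> conset_fin A b" for v
  proof -
    obtain c where c: "v \<in> carrier_vec n" "\<And>w. w \<in> V \<Longrightarrow> 0 \<le> c w" "\<And>j. j < n \<Longrightarrow> v $ j = (\<Sum>w\<in>V. c w * w $ j)"
      using \<open>v \<in> conset_fin A b\<close> unfolding eq by blast
    show ?thesis
      by (rule conset_conic_combination[OF A b V(1), of c "\<lambda>w. w"]) (use c VK in auto)
  qed
  then have "conset_fin A b = conset k A b" using \<open>1 \<le> k\<close> unfolding conset_fin_def by auto
  then show ?thesis using \<open>1 \<le> k\<close> by blast
qed

text \<open>Multiplication by \<open>A\<close> raises every exponent by one; only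
  \<open>k - 1\<close> leaves the range, and the hypothesis brings it back. By induction all
  \<open>A^i b\<close> stay inside.\<close>

lemma conset_fin_eq_conset_if_mem:
  assumes A: "A \<in> carrier_mat n n" and b: "b \<in> carrier_vec n"
    and "k \<ge> 1" and Xk: "(A ^\<^sub>m k) *\<^sub>v b \<in> conset k A b"
  shows "conset_fin A b = conset k A b"
proof -
  have X: "(A ^\<^sub>m i) *\<^sub>v b \<in> carrier_vec n" for i by (rule pow_mult_vec_carrier[OF A b])
  have Suc_X: "((A ^\<^sub>m Suc i) *\<^sub>v b) $ j = (\<Sum>l<n. A $$ (j, l) * ((A ^\<^sub>m i) *\<^sub>v b) $ l)" if "j < n" for i j
    unfolding pow_mat_Suc_left[OF A] assoc_mult_mat_vec[OF A pow_carrier_mat[OF A] b]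
    by (rule mult_mat_vec_index_sum[OF A X that])
  have mem: "(A ^\<^sub>m i) *\<^sub>v b \<in> conset k A b" for i
  proof (induction i)
    case 0
    show ?case using \<open>k \<ge> 1\<close> by (intro pow_mult_vec_mem_conset[OF A b]) auto
  next
    case (Suc i)
    then obtain c where c: "\<And>l. l < k \<Longrightarrow> 0 \<le> c l"
      "\<And>j. j < n \<Longrightarrow> ((A ^\<^sub>m i) *\<^sub>v b) $ j = (\<Sum>l<k. c l * ((A ^\<^sub>m l) *\<^sub>v b) $ j)"
      unfolding mem_conset_iff[OF A b] by blast
    show ?case
    proof (rule conset_conic_combination[OF A b, of "{..<k}" c "\<lambda>l. (A ^\<^sub>m Suc l) *\<^sub>v b"])
      fix l assume "l \<in> {..<k}"
      then consider "Suc l < k" | "Suc l = k" by fastforce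
      then show "(A ^\<^sub>m Suc l) *\<^sub>v b \<in> conset k A b"
        using Xk pow_mult_vec_mem_conset[OF A b, of "Suc l" k] by cases auto
    next
      fix j assume j: "j < n"
      have "((A ^\<^sub>m Suc i) *\<^sub>v b) $ j = (\<Sum>p<n. \<Sum>l<k. c l * (A $$ (j, p) * ((A ^\<^sub>m l) *\<^sub>v b) $ p))"
        unfolding Suc_X[OF j] by (intro sum.cong refl) (simp add: c(2) sum_distrib_left mult_ac)
      also have "\<dots> = (\<Sum>l<k. c l * ((A ^\<^sub>m Suc l) *\<^sub>v b) $ j)"
        unfolding Suc_X[OF j] by (subst sum.swap) (simp add: sum_distrib_left)
      finally show "((A ^\<^sub>m Suc i) *\<^sub>v b) $ j = (\<Sum>l<k. c l * ((A ^\<^sub>m Suc l) *\<^sub>v b) $ j)" .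
    qed (use c X in \<open>auto simp del: pow_mat.simps\<close>)
  qed
  have "conset l A b \<subseteq> conset k A b" for l
  proof
    fix v assume "v \<in> conset l A b"
    then obtain c where v: "v \<in> carrier_vec n" and c: "\<And>i. i < l \<Longrightarrow> 0 \<le> c i"
      "\<And>j. j < n \<Longrightarrow> v $ j = (\<Sum>i<l. c i * ((A ^\<^sub>m i) *\<^sub>v b) $ j)"
      unfolding mem_conset_iff[OF A b] by blast
    show "v \<in> conset k A b"
      by (rule conset_conic_combination[OF A b, of "{..<l}" c "\<lambda>i. (A ^\<^sub>m i) *\<^sub>v b"]) (use v c mem in auto)
  qed
  then show ?thesis unfolding conset_fin_def using \<open>k \<ge> 1\<close> by auto
qed

lemma polyhedral_cone_conset:
  assumes A: "A \<in> carrier_mat n n" and b: "b \<in> carrier_vec n"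
  shows "polyhedral_cone n (conset k A b)"
  unfolding polyhedral_cone_iff
proof (intro exI[of _ "(\<lambda>i. (A ^\<^sub>m i) *\<^sub>v b) ` {..<k}"] conjI equalityI subsetI)
  let ?X = "\<lambda>i. (A ^\<^sub>m i) *\<^sub>v b"
  let ?V = "?X ` {..<k}"
  fix v assume "v \<in> conset k A b"
  then obtain c where v: "v \<in> carrier_vec n" and c: "\<And>i. i < k \<Longrightarrow> 0 \<le> c i"
    "\<And>j. j < n \<Longrightarrow> v $ j = (\<Sum>i<k. c i * ?X i $ j)"
    unfolding mem_conset_iff[OF A b] by blast
  \<comment> \<open>Generators form a set, so exponents with coinciding vectors must pool their
    coefficients.\<close>
  define d where "d w = (\<Sum>i | i \<in> {..<k} \<and> ?X i = w. c i)" for w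
  have "v $ j = (\<Sum>w\<in>?V. d w * w $ j)" if "j < n" for j
  proof -
    have "v $ j = (\<Sum>w\<in>?V. \<Sum>i | i \<in> {..<k} \<and> ?X i = w. c i * ?X i $ j)"
      unfolding c(2)[OF that] by (rule sum.image_gen) simp
    also have "\<dots> = (\<Sum>w\<in>?V. d w * w $ j)"
      unfolding d_def sum_distrib_right by (intro sum.cong refl) auto
    finally show ?thesis .
  qed
  moreover have "0 \<le> d w" for w unfolding d_def using c(1) by (intro sum_nonneg) auto
  ultimately show "v \<in> {v \<in> carrier_vec n. \<exists>c. (\<forall>w\<in>?V. 0 \<le> c w) \<and> (\<forall>j<n. v $ j = (\<Sum>w\<in>?V. c w * w $ j))}"
    using v by blast
next
  let ?X = "\<lambda>i. (A ^\<^sub>m i) *\<^sub>v b"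
  let ?V = "?X ` {..<k}"
  fix v assume "v \<in> {v \<in> carrier_vec n. \<exists>c. (\<forall>w\<in>?V. 0 \<le> c w) \<and> (\<forall>j<n. v $ j = (\<Sum>w\<in>?V. c w * w $ j))}"
  then obtain c where v: "v \<in> carrier_vec n" "\<forall>w\<in>?V. 0 \<le> c w" "\<forall>j<n. v $ j = (\<Sum>w\<in>?V. c w * w $ j)"
    by blast
  show "v \<in> conset k A b"
    by (rule conset_conic_combination[OF A b, of ?V c "\<lambda>w. w"])
      (use v pow_mult_vec_mem_conset[OF A b] in auto)
qed (use A b pow_mult_vec_carrier[OF A b] in auto)

text \<open>Polyhedrality amounts to \<open>q(A) b = 0\<close> and a recursion to
  \<open>q(A) = 0\<close>, for a monic \<open>q\<close> whose lower coefficients are nonpositive. As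
  \<open>q(A)\<close> commutes with \<open>A\<close> and \<open>b\<close> is cyclic, the two
  conditions agree.\<close>

lemma nonneg_recursion_iff_polyhedral_cone:
  assumes A: "A \<in> carrier_mat n n" and b: "b \<in> carrier_vec n" and "n \<ge> 1"
    and K: "det (krylov n A b) \<noteq> 0"
  shows "polyhedral_cone n (conset_fin A b) \<longleftrightarrow> nonneg_recursion A"
    and "polyhedral_cone n (conset_fin A b) \<Longrightarrow>
      \<exists>k\<ge>1. k \<ge> vertex_number A b \<and> conset_fin A b = conset k A b"
proof -
  have pol: "\<exists>k\<ge>1. (A ^\<^sub>m k) *\<^sub>v b \<in> conset k A b \<and> conset_fin A b = conset k A b"
    if pc: "polyhedral_cone n (conset_fin A b)"
  proof -
    obtain k where k: "k \<ge> 1" "conset_fin A b = conset k A b"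
      using conset_fin_eq_conset_if_polyhedral[OF A b pc] by blast
    \<comment> \<open>One step beyond the stabilised set still lies in it, which is the relation
      sought.\<close>
    have "(A ^\<^sub>m k) *\<^sub>v b \<in> conset (Suc k) A b" by (rule pow_mult_vec_mem_conset[OF A b]) simp
    then have "(A ^\<^sub>m k) *\<^sub>v b \<in> conset_fin A b" unfolding conset_fin_def by auto
    then show ?thesis using k by blast
  qed
  show "polyhedral_cone n (conset_fin A b) \<longleftrightarrow> nonneg_recursion A"
  proof
    assume "polyhedral_cone n (conset_fin A b)"
    then obtain k c where c: "\<And>i. i < k \<Longrightarrow> 0 \<le> c i"
      "\<And>j. j < n \<Longrightarrow> ((A ^\<^sub>m k) *\<^sub>v b) $ j = (\<Sum>i<k. c i * ((A ^\<^sub>m i) *\<^sub>v b) $ j)"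
      using pol unfolding mem_conset_iff[OF A b] by blast
    define q where "q = monom 1 k - (\<Sum>i<k. monom (c i) i)"
    have coeff_q: "coeff q i = (if i = k then 1 else if i < k then - c i else 0)" for i
      by (auto simp: q_def coeff_sum)
    have deg: "degree q \<le> k" by (rule degree_le) (simp add: coeff_q)
    have "poly_mat A q * A = A * poly_mat A q"
      using poly_mat_mult[OF A, of q "[:0, 1:]"] poly_mat_mult[OF A, of "[:0, 1:]" q]
      by (simp only: poly_mat_X[OF A] mult.commute)
    moreover have "poly_mat A q *\<^sub>v b = 0\<^sub>v n"
    proof (rule eq_vecI)
      fix j assume "j < dim_vec (0\<^sub>v n :: real vec)"
      then have j: "j < n" by simp
      show "(poly_mat A q *\<^sub>v b) $ j = 0\<^sub>v n $ j"
        unfolding poly_mat_mult_vec_index[OF A b j deg] using j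
        by (simp add: lessThan_Suc_atMost[symmetric] coeff_q c(2) sum_negf)
    qed (use A in auto)
    ultimately have q0: "poly_mat A q = 0\<^sub>m n n"
      by (intro commuting_mat_eq_0_if_krylov[OF A b K]) (use A in auto)
    have "(A ^\<^sub>m k) $$ (i, j) = (\<Sum>l<k. c l * (A ^\<^sub>m l) $$ (i, j))" if "i < n" "j < n" for i j
    proof -
      have "0 = (\<Sum>l\<le>k. coeff q l * (A ^\<^sub>m l) $$ (i, j))"
        unfolding index_poly_mat[OF A that deg, symmetric] q0 using that by simp
      then show ?thesis by (simp add: lessThan_Suc_atMost[symmetric] coeff_q sum_negf)
    qed
    then show "nonneg_recursion A" unfolding nonneg_recursion_iff[OF A \<open>n \<ge> 1\<close>] using c(1) by blast
  next
    assume "nonneg_recursion A"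
    then obtain m c where c: "\<And>i. i < m \<Longrightarrow> 0 \<le> c i"
      "\<And>i j. i < n \<Longrightarrow> j < n \<Longrightarrow> (A ^\<^sub>m m) $$ (i, j) = (\<Sum>k<m. c k * (A ^\<^sub>m k) $$ (i, j))"
      unfolding nonneg_recursion_iff[OF A \<open>n \<ge> 1\<close>] by blast
    \<comment> \<open>For \<open>m = 0\<close> the recursion would equate the identity with an empty
      sum.\<close>
    have "m \<ge> 1"
    proof (rule ccontr)
      assume "\<not> m \<ge> 1"
      then have "m = 0" by simp
      then show False using c(2)[of 0 0] \<open>n \<ge> 1\<close> A by simp
    qed
    have "(A ^\<^sub>m m) *\<^sub>v b \<in> conset m A b"
      unfolding mem_conset_iff[OF A b]
    proof (intro conjI exI[of _ c] allI impI)
      fix i assume i: "i < n"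
      have "((A ^\<^sub>m m) *\<^sub>v b) $ i = (\<Sum>j<n. \<Sum>k<m. c k * ((A ^\<^sub>m k) $$ (i, j) * b $ j))"
        unfolding mult_mat_vec_index_sum[OF pow_carrier_mat[OF A] b i]
        by (intro sum.cong refl) (simp add: c(2) i sum_distrib_right mult.assoc)
      also have "\<dots> = (\<Sum>k<m. c k * ((A ^\<^sub>m k) *\<^sub>v b) $ i)"
        unfolding mult_mat_vec_index_sum[OF pow_carrier_mat[OF A] b i]
        by (subst sum.swap) (simp add: sum_distrib_left)
      finally show "((A ^\<^sub>m m) *\<^sub>v b) $ i = (\<Sum>k<m. c k * ((A ^\<^sub>m k) *\<^sub>v b) $ i)" .
    qed (use c pow_mult_vec_carrier[OF A b] in auto)
    from conset_fin_eq_conset_if_mem[OF A b \<open>m \<ge> 1\<close> this]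
    show "polyhedral_cone n (conset_fin A b)" using polyhedral_cone_conset[OF A b] by simp
  qed
  assume "polyhedral_cone n (conset_fin A b)"
  then obtain k where k: "k \<ge> 1" "(A ^\<^sub>m k) *\<^sub>v b \<in> conset k A b" "conset_fin A b = conset k A b"
    using pol by blast
  then have "vertex_number A b \<le> k" unfolding vertex_number_def by (intro Least_le) simp
  then show "\<exists>k\<ge>1. k \<ge> vertex_number A b \<and> conset_fin A b = conset k A b" using k by blast
qed

subsection \<open>Nonnegative recursions and positive eigenvalues\<close>

lemma index_mult_mat_sum:
  assumes "X \<in> carrier_mat k m" "Y \<in> carrier_mat m l" "i < k" "j < l"
  shows "(X * Y) $$ (i, j) = (\<Sum>p<m. X $$ (i, p) * Y $$ (p, j))"
  using assms by (auto simp: scalar_prod_def atLeast0LessThan)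

lemma index_complex_mat_pow:
  assumes "A \<in> carrier_mat n n" "i < n" "j < n"
  shows "(complex_mat A ^\<^sub>m k) $$ (i, j) = of_real ((A ^\<^sub>m k) $$ (i, j))"
proof -
  have "complex_mat A ^\<^sub>m k = complex_mat (A ^\<^sub>m k)" by (rule of_real_hom.mat_hom_pow[OF assms(1), symmetric])
  then show ?thesis using assms by simp
qed

text \<open>All exponents in the support are congruent to \<open>n\<close> modulo \<open>g\<close>,
  hence of the form \<open>n mod g + g * j\<close>; \<open>P\<close> gathers the coefficients by
  \<open>j\<close>.\<close>

lemma poly_eq_monom_mult_pcompose:
  fixes p :: "complex poly"
  assumes "degree p = n" and "0 < g" and g: "\<And>k. coeff p k \<noteq> 0 \<Longrightarrow> g dvd n - k"
  shows "\<exists>P. p = monom 1 (n mod g) * pcompose P (monom 1 g)"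
proof -
  define a where "a = n mod g"
  define P where "P = (\<Sum>j\<le>n div g. monom (coeff p (a + g * j)) j)"
  have n: "n = a + g * (n div g)" by (simp add: a_def)
  have "poly p x = poly (monom 1 a * pcompose P (monom 1 g)) x" for x
  proof -
    have "poly p x = (\<Sum>k\<le>n. coeff p k * x ^ k)" by (simp add: poly_altdef assms(1))
    also have "\<dots> = (\<Sum>k\<in>(\<lambda>j. a + g * j) ` {..n div g}. coeff p k * x ^ k)"
    proof (rule sum.mono_neutral_right)
      show "(\<lambda>j. a + g * j) ` {..n div g} \<subseteq> {..n}"
      proof
        fix k assume "k \<in> (\<lambda>j. a + g * j) ` {..n div g}"
        then obtain j where j: "j \<le> n div g" "k = a + g * j" by auto
        then have "k \<le> a + g * (n div g)" by simp
          also have "\<dots> = n" by (rule n[symmetric])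
          finally show "k \<in> {..n}" by simp
        qed
      show "\<forall>k\<in>{..n} - (\<lambda>j. a + g * j) ` {..n div g}. coeff p k * x ^ k = 0"
      proof
        fix k assume k: "k \<in> {..n} - (\<lambda>j. a + g * j) ` {..n div g}"
        have "coeff p k = 0"
        proof (rule ccontr)
          assume "coeff p k \<noteq> 0"
          then have "g dvd n - k" by (rule g)
          then have "k mod g = a" using k mod_eq_dvd_iff_nat[of k n g] by (simp add: a_def)
          then have "k = a + g * (k div g)" by (metis mult_div_mod_eq add.commute)
          moreover have "k div g \<le> n div g" using k by (simp add: div_le_mono)
          ultimately show False using k by blast
        qed
        then show "coeff p k * x ^ k = 0" by simp
      qed
    qed simp
    also have "\<dots> = (\<Sum>j\<le>n div g. coeff p (a + g * j) * x ^ (a + g * j))"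
      using \<open>0 < g\<close> by (subst sum.reindex) (auto simp: inj_on_def)
    also have "\<dots> = poly (monom 1 a * pcompose P (monom 1 g)) x"
      unfolding power_add power_mult[of x g]
      by (simp add: P_def poly_pcompose poly_monom poly_sum sum_distrib_left mult.left_commute)
    finally show ?thesis .
  qed
  then have "p = monom 1 a * pcompose P (monom 1 g)" by (simp add: poly_eq_poly_eq_iff[symmetric] fun_eq_iff)
  then show ?thesis unfolding a_def by blast
qed

text \<open>Put \<open>y = r * x\<close> with \<open>r > 1\<close>. Scaling the scalar recursion for
  \<open>x\<close> by \<open>r^m\<close> and subtracting the one for \<open>y\<close> leaves a
  vanishing sum of nonnegative terms \<open>c_k x^k (r^m - r^k)\<close>. So every
  \<open>c_k x^k\<close> is 0, which forces \<open>x^m = 0\<close>.\<close>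

lemma nonneg_recursion_positive_eigenvalue_unique:
  assumes A: "A \<in> carrier_mat n n" and "n \<ge> 1" and "nonneg_recursion A"
    and x: "0 < x" "eigenvalue (complex_mat A) (of_real x)"
    and y: "eigenvalue (complex_mat A) (of_real y)"
  shows "\<not> x < y"
proof
  assume "x < y"
  have cA: "complex_mat A \<in> carrier_mat n n" using A by simp
  obtain m c where c: "\<And>k. k < m \<Longrightarrow> 0 \<le> c k" and rec:
    "\<And>i j. i < n \<Longrightarrow> j < n \<Longrightarrow> (A ^\<^sub>m m) $$ (i, j) = (\<Sum>k<m. c k * (A ^\<^sub>m k) $$ (i, j))"
    using \<open>nonneg_recursion A\<close> unfolding nonneg_recursion_iff[OF A \<open>n \<ge> 1\<close>] by blast
  define q :: "complex poly" where "q = monom 1 m - (\<Sum>k<m. monom (of_real (c k)) k)"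
  have coeff_q: "coeff q i = (if i = m then 1 else if i < m then - of_real (c i) else 0)" for i
    by (auto simp: q_def coeff_sum)
  have deg: "degree q \<le> m" by (rule degree_le) (simp add: coeff_q)
  have q0: "poly_mat (complex_mat A) q = 0\<^sub>m n n"
  proof (rule eq_matI)
    fix i j assume "i < dim_row (0\<^sub>m n n :: complex mat)" "j < dim_col (0\<^sub>m n n :: complex mat)"
    then have ij: "i < n" "j < n" by auto
    show "poly_mat (complex_mat A) q $$ (i, j) = 0\<^sub>m n n $$ (i, j)"
      unfolding index_poly_mat[OF cA ij deg]
      using ij by (simp add: lessThan_Suc_atMost[symmetric] coeff_q sum_negf index_complex_mat_pow[OF A ij] rec)
  qed (use A in auto)
  have root: "t ^ m = (\<Sum>k<m. c k * t ^ k)" if ev: "eigenvalue (complex_mat A) (of_real t)" for t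
  proof -
    obtain v where v: "v \<in> carrier_vec n" "v \<noteq> 0\<^sub>v n" "complex_mat A *\<^sub>v v = of_real t \<cdot>\<^sub>v v"
      using ev A unfolding eigenvalue_def eigenvector_def by auto
    obtain l where l: "l < n" "v $ l \<noteq> 0" using v(1,2) by (metis carrier_vecD eq_vecI index_zero_vec)
    have "poly q (of_real t) \<cdot>\<^sub>v v = 0\<^sub>m n n *\<^sub>v v"
      unfolding poly_mat_eigenvector[OF cA v(1,3), symmetric] q0 ..
    then have "(poly q (of_real t) \<cdot>\<^sub>v v) $ l = 0" using v(1) l(1) by simp
    then have "poly q (of_real t) = 0" using v(1) l by simp
    then have "of_real (t ^ m) = (of_real (\<Sum>k<m. c k * t ^ k) :: complex)"
      by (simp add: q_def poly_monom poly_sum)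
    then show ?thesis by (simp only: of_real_eq_iff)
  qed
  define r where "r = y / x"
  have r: "1 < r" using \<open>x < y\<close> x(1) by (simp add: r_def)
  have y_eq: "y = r * x" using x(1) by (simp add: r_def)
  have "(\<Sum>k<m. c k * x ^ k * (r ^ m - r ^ k)) = r ^ m * x ^ m - y ^ m"
    unfolding root[OF x(2)] root[OF y] unfolding y_eq
    by (simp add: right_diff_distrib sum_subtractf sum_distrib_left power_mult_distrib mult_ac)
  then have "(\<Sum>k<m. c k * x ^ k * (r ^ m - r ^ k)) = 0" by (simp add: y_eq power_mult_distrib)
  moreover have "0 \<le> c k * x ^ k * (r ^ m - r ^ k)" if "k < m" for k
    using c[OF that] x(1) r that by (simp add: power_increasing)
  ultimately have "\<forall>k<m. c k * x ^ k * (r ^ m - r ^ k) = 0"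
    by (subst (asm) sum_nonneg_eq_0_iff) auto
  moreover have "r ^ m - r ^ k \<noteq> 0" if "k < m" for k
    using power_strict_increasing[OF that r] by simp
  ultimately have "c k * x ^ k = 0" if "k < m" for k using that by auto
  then have "(\<Sum>k<m. c k * x ^ k) = 0" by (intro sum.neutral) auto
  then have "x ^ m = 0" by (simp only: root[OF x(2)])
  then show False using x(1) by simp
qed

text \<open>The similarity given by \<open>d\<close> turns \<open>p(A) = 0\<close> into
  \<open>p(z A) = 0\<close>. Subtracting \<open>z^n p(A)\<close> cancels the leading term, so
  minimality kills every coefficient \<open>p_k (z^k - z^n)\<close>.\<close>

lemma peripheral_eigenvalue_power_coeff:
  fixes A :: "real mat" and z :: complex
  assumes A: "A \<in> carrier_mat n n" and "n \<ge> 1"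
    and p: "poly_mat (complex_mat A) p = 0\<^sub>m n n" "degree p = n"
    and min: "\<And>q. poly_mat (complex_mat A) q = 0\<^sub>m n n \<Longrightarrow> degree q < n \<Longrightarrow> q = 0"
    and d0: "\<And>i. i < n \<Longrightarrow> d i \<noteq> 0"
    and d: "\<And>i j. i < n \<Longrightarrow> j < n \<Longrightarrow> of_real (A $$ (i, j)) * d j = z * d i * of_real (A $$ (i, j))"
    and "z \<noteq> 0" and k: "coeff p k \<noteq> 0"
  shows "z ^ (n - k) = 1"
proof -
  have cA: "complex_mat A \<in> carrier_mat n n" using A by simp
  define q where "q = (\<Sum>k\<le>n. monom (coeff p k * (z ^ k - z ^ n)) k)"
  have coeff_q: "coeff q i = (if i \<le> n then coeff p i * (z ^ i - z ^ n) else 0)" for i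
    by (auto simp: q_def coeff_sum)
  have "degree q \<le> n - 1"
  proof (rule degree_le, intro allI impI)
    fix i assume "n - 1 < i"
    then have "i = n \<or> n < i" by auto
    then show "coeff q i = 0" by (auto simp: coeff_q)
  qed
  then have deg: "degree q < n" "degree q \<le> n" using \<open>n \<ge> 1\<close> by auto
  have "poly_mat (complex_mat A) q = 0\<^sub>m n n"
  proof (rule eq_matI)
    fix i j assume "i < dim_row (0\<^sub>m n n :: complex mat)" "j < dim_col (0\<^sub>m n n :: complex mat)"
    then have ij: "i < n" "j < n" by auto
    define a where "a k = (of_real ((A ^\<^sub>m k) $$ (i, j)) :: complex)" for k
    have 0: "(\<Sum>k\<le>n. coeff p k * a k) = 0"
      using index_poly_mat[OF cA ij eq_refl[OF p(2)]] ij
      by (simp add: p(1) a_def index_complex_mat_pow[OF A ij])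
    have "(\<Sum>k\<le>n. coeff p k * z ^ k * a k) * d i = (\<Sum>k\<le>n. coeff p k * (z ^ k * d i * a k))"
      unfolding sum_distrib_right by (intro sum.cong refl) (simp add: mult_ac)
    also have "\<dots> = (\<Sum>k\<le>n. coeff p k * (a k * d j))"
      unfolding a_def by (simp only: phases_pow_mat[OF A d ij])
    also have "\<dots> = (\<Sum>k\<le>n. coeff p k * a k) * d j" by (simp add: sum_distrib_right mult.assoc)
    also have "\<dots> = 0" by (simp add: 0)
    finally have 1: "(\<Sum>k\<le>n. coeff p k * z ^ k * a k) = 0" using d0[OF ij(1)] by simp
    have "poly_mat (complex_mat A) q $$ (i, j) = (\<Sum>k\<le>n. coeff p k * (z ^ k - z ^ n) * a k)"
      unfolding index_poly_mat[OF cA ij deg(2)]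
      by (intro sum.cong refl) (simp add: coeff_q a_def index_complex_mat_pow[OF A ij])
    also have "\<dots> = (\<Sum>k\<le>n. coeff p k * z ^ k * a k) - z ^ n * (\<Sum>k\<le>n. coeff p k * a k)"
      by (simp add: sum_distrib_left sum_subtractf[symmetric] algebra_simps)
    finally show "poly_mat (complex_mat A) q $$ (i, j) = 0\<^sub>m n n $$ (i, j)" using ij 0 1 by simp
  qed (use A in auto)
  then have "q = 0" using min deg by blast
  have kn: "k \<le> n" using k p(2) le_degree by blast
  then have "coeff p k * (z ^ k - z ^ n) = 0" using coeff_q[of k] \<open>q = 0\<close> by simp
  then have "z ^ k = z ^ n" using k by simp
  moreover have "z ^ k * z ^ (n - k) = z ^ n" using kn by (simp flip: power_add)
  ultimately have "z ^ k * z ^ (n - k) = z ^ k * 1" by (simp only: mult_1_right)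
  then show ?thesis using \<open>z \<noteq> 0\<close> by (subst (asm) mult_cancel_left) simp
qed

text \<open>The columns of \<open>M\<close> lie in the range and in the kernel of
  \<open>B - r\<close>. In the coordinates given by \<open>T\<close>, row 0 of \<open>D - r\<close>
  is zero, which clears row 0 of \<open>M'\<close>; below it, a nonzero column would be an
  eigenvector of \<open>B2\<close> for \<open>r\<close>. In effect there is no Jordan chain of
  length 2 at \<open>r\<close>.\<close>

lemma block_diag_eigenvector_not_in_range:
  fixes B :: "'a :: field mat"
  assumes c: "B \<in> carrier_mat (Suc m) (Suc m)" "T \<in> carrier_mat (Suc m) (Suc m)"
      "Ti \<in> carrier_mat (Suc m) (Suc m)" "D \<in> carrier_mat (Suc m) (Suc m)" "B2 \<in> carrier_mat m m"
    and inv: "T * Ti = 1\<^sub>m (Suc m)" "Ti * T = 1\<^sub>m (Suc m)" and B: "B = T * D * Ti"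
    and D: "D $$ (0, 0) = r" "\<And>j. j < m \<Longrightarrow> D $$ (0, Suc j) = 0" "\<And>i. i < m \<Longrightarrow> D $$ (Suc i, 0) = 0"
      "\<And>i j. i < m \<Longrightarrow> j < m \<Longrightarrow> D $$ (Suc i, Suc j) = B2 $$ (i, j)"
    and B2: "\<not> eigenvalue B2 r"
    and MN: "M \<in> carrier_mat (Suc m) (Suc m)" "N \<in> carrier_mat (Suc m) (Suc m)"
      "M = B * N + (- r) \<cdot>\<^sub>m N" "B * M = r \<cdot>\<^sub>m M"
  shows "M = 0\<^sub>m (Suc m) (Suc m)"
proof -
  let ?n = "Suc m"
  have TiB: "Ti * B = D * Ti"
  proof -
    have "Ti * B = Ti * (T * (D * Ti))" using c unfolding B by (simp add: assoc_mult_mat[of _ ?n ?n _ ?n _ ?n])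
    also have "\<dots> = (Ti * T) * (D * Ti)"
      by (rule assoc_mult_mat[OF c(3) c(2) mult_carrier_mat[OF c(4) c(3)], symmetric])
    finally show ?thesis using inv(2) left_mult_one_mat[OF mult_carrier_mat[OF c(4) c(3)]] by simp
  qed
  define M' where "M' = Ti * M"
  define N' where "N' = Ti * N"
  have cM': "M' \<in> carrier_mat ?n ?n" and cN': "N' \<in> carrier_mat ?n ?n"
    unfolding M'_def N'_def using c MN by auto
  have DM: "D * M' = r \<cdot>\<^sub>m M'"
  proof -
    have "D * M' = (Ti * B) * M" unfolding M'_def TiB by (rule assoc_mult_mat[OF c(4) c(3) MN(1), symmetric])
    also have "\<dots> = Ti * (r \<cdot>\<^sub>m M)" unfolding MN(4)[symmetric] by (rule assoc_mult_mat[OF c(3) c(1) MN(1)])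
    also have "\<dots> = r \<cdot>\<^sub>m M'" unfolding M'_def by (rule mult_smult_distrib[OF c(3) MN(1)])
    finally show ?thesis .
  qed
  have M'N': "M' = D * N' + (- r) \<cdot>\<^sub>m N'"
  proof -
    have "M' = Ti * (B * N) + Ti * ((- r) \<cdot>\<^sub>m N)"
      unfolding M'_def MN(3) by (rule mult_add_distrib_mat[OF c(3)]) (use c MN in auto)
    also have "Ti * (B * N) = D * N'"
      unfolding N'_def assoc_mult_mat[OF c(3) c(1) MN(2), symmetric] TiB by (rule assoc_mult_mat[OF c(4) c(3) MN(2)])
    also have "Ti * ((- r) \<cdot>\<^sub>m N) = (- r) \<cdot>\<^sub>m N'" unfolding N'_def by (rule mult_smult_distrib[OF c(3) MN(2)])
    finally show ?thesis .
  qed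
  have row0: "M' $$ (0, j) = 0" if j: "j < ?n" for j
  proof -
    have "(D * N') $$ (0, j) = r * N' $$ (0, j)"
      unfolding index_mult_mat_sum[OF c(4) cN' zero_less_Suc j] sum.lessThan_Suc_shift by (simp add: D)
    moreover have "M' $$ (0, j) = (D * N') $$ (0, j) + (- r) * N' $$ (0, j)"
      by (subst M'N') (use j c cN' in simp)
    ultimately show ?thesis by simp
  qed
  have rows: "M' $$ (Suc i, j) = 0" if i: "i < m" and j: "j < ?n" for i j
  proof (rule ccontr)
    assume nz: "M' $$ (Suc i, j) \<noteq> 0"
    define w where "w = vec m (\<lambda>i. M' $$ (Suc i, j))"
    have w: "w \<in> carrier_vec m" by (simp add: w_def)
    have "w $ i \<noteq> 0" using nz i by (simp add: w_def)
    then have "w \<noteq> 0\<^sub>v m" using i by auto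
    moreover have "B2 *\<^sub>v w = r \<cdot>\<^sub>v w"
    proof (rule eq_vecI)
      fix k assume "k < dim_vec (r \<cdot>\<^sub>v w)"
      then have k: "k < m" using w by simp
      have "(B2 *\<^sub>v w) $ k = (\<Sum>l<m. D $$ (Suc k, Suc l) * M' $$ (Suc l, j))"
        unfolding mult_mat_vec_index_sum[OF c(5) w k] using k by (intro sum.cong refl) (simp add: D w_def)
      also have "\<dots> = (D * M') $$ (Suc k, j)"
        unfolding index_mult_mat_sum[OF c(4) cM' Suc_mono[OF k] j] sum.lessThan_Suc_shift
        using k by (simp add: D)
      also have "\<dots> = r * M' $$ (Suc k, j)" unfolding DM using k j cM' by simp
      finally show "(B2 *\<^sub>v w) $ k = (r \<cdot>\<^sub>v w) $ k" using k by (simp add: w_def)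
    qed (use c w in auto)
    ultimately have "eigenvalue B2 r" unfolding eigenvalue_def eigenvector_def using w c(5) by auto
    with B2 show False by simp
  qed
  have "M' = 0\<^sub>m ?n ?n"
  proof (rule eq_matI)
    fix i j assume "i < dim_row (0\<^sub>m ?n ?n :: 'a mat)" "j < dim_col (0\<^sub>m ?n ?n :: 'a mat)"
    then show "M' $$ (i, j) = 0\<^sub>m ?n ?n $$ (i, j)" using row0 rows by (cases i) auto
  qed (use cM' in auto)
  have "M = (T * Ti) * M" unfolding inv(1) using left_mult_one_mat[OF MN(1)] by simp
  also have "\<dots> = T * M'" unfolding M'_def by (rule assoc_mult_mat[OF c(2) c(3) MN(1)])
  also have "\<dots> = 0\<^sub>m ?n ?n" unfolding \<open>M' = 0\<^sub>m ?n ?n\<close> by (rule right_mult_zero_mat[OF c(2)])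
  finally show ?thesis .
qed

text \<open>The first column of \<open>T\<close> is an eigenvector; it is nonzero because
  \<open>T\<close> is invertible.\<close>

lemma block_diag_eigenvalue:
  fixes B :: "'a :: field mat"
  assumes c: "T \<in> carrier_mat (Suc m) (Suc m)"
      "Ti \<in> carrier_mat (Suc m) (Suc m)" "D \<in> carrier_mat (Suc m) (Suc m)"
    and inv: "Ti * T = 1\<^sub>m (Suc m)" and B: "B = T * D * Ti"
    and D: "D $$ (0, 0) = r" "\<And>i. i < m \<Longrightarrow> D $$ (Suc i, 0) = 0"
  shows "eigenvalue B r"
proof -
  let ?n = "Suc m"
  have TD: "T * D \<in> carrier_mat ?n ?n" using c by simp
  have cB: "B \<in> carrier_mat ?n ?n" unfolding B using mult_carrier_mat[OF TD c(2)] .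
  have BT: "B * T = T * D"
    unfolding B assoc_mult_mat[OF TD c(2) c(1)] inv by (rule right_mult_one_mat[OF TD])
  define v where "v = col T 0"
  have v: "v \<in> carrier_vec ?n" unfolding v_def using c(1) by (intro carrier_vecI) simp
  have "B *\<^sub>v v = r \<cdot>\<^sub>v v"
  proof (rule eq_vecI)
    fix i assume "i < dim_vec (r \<cdot>\<^sub>v v)"
    then have i: "i < ?n" using v by simp
    have "(B *\<^sub>v v) $ i = (B * T) $$ (i, 0)"
      using i cB c(1) by (simp add: v_def)
    also have "\<dots> = T $$ (i, 0) * r"
      unfolding BT index_mult_mat_sum[OF c(1) c(3) i zero_less_Suc] sum.lessThan_Suc_shift by (simp add: D)
    finally show "(B *\<^sub>v v) $ i = (r \<cdot>\<^sub>v v) $ i" using i c(1) by (simp add: v_def)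
  qed (use cB v in auto)
  moreover have "v \<noteq> 0\<^sub>v ?n"
  proof
    assume v0: "v = 0\<^sub>v ?n"
    have "1 = (Ti * T) $$ (0, 0)" unfolding inv by simp
    also have "\<dots> = (\<Sum>p<?n. Ti $$ (0, p) * T $$ (p, 0))"
      by (rule index_mult_mat_sum[OF c(2) c(1)]) auto
    also have "\<dots> = (\<Sum>p<?n. Ti $$ (0, p) * v $ p)" using c(1) by (intro sum.cong refl) (simp add: v_def)
    also have "\<dots> = 0" unfolding v0 by simp
    finally show False by simp
  qed
  ultimately show ?thesis unfolding eigenvalue_def eigenvector_def using v cB by auto
qed

lemma ex_complex_root:
  assumes "0 < g"
  shows "\<exists>l :: complex. l ^ g = c"
proof -
  have "rcis (root g (cmod c)) (Arg c / g) ^ g = rcis (cmod c) (Arg c)"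
    using assms by (simp add: DeMoivre2)
  then show ?thesis by (metis rcis_cmod_Arg)
qed

text \<open>The hypothesis \<open>simple\<close> encodes that range and kernel of
  \<open>A - \<rho>\<close> meet only in 0; for the minimal polynomial this rules out a double root
  at \<rho>.\<close>

lemma nonneg_recursion_if_no_other_positive_eigenvalue:
  fixes A :: "real mat"
  defines "\<rho> \<equiv> spectral_radius (complex_mat A)"
  assumes A: "A \<in> carrier_mat n n" and nn: "\<And>i j. i < n \<Longrightarrow> j < n \<Longrightarrow> 0 \<le> A $$ (i, j)"
    and irr: "irreducible_mat A" and "n \<ge> 1"
    and b: "b \<in> carrier_vec n" and K: "det (krylov n A b) \<noteq> 0"
    and simple: "\<And>M N. M \<in> carrier_mat n n \<Longrightarrow> N \<in> carrier_mat n n \<Longrightarrow>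
      M = complex_mat A * N + (- of_real \<rho>) \<cdot>\<^sub>m N \<Longrightarrow> complex_mat A * M = of_real \<rho> \<cdot>\<^sub>m M \<Longrightarrow> M = 0\<^sub>m n n"
    and ev_\<rho>: "eigenvalue (complex_mat A) (of_real \<rho>)"
    and nopos: "\<And>x. 0 < x \<Longrightarrow> eigenvalue (complex_mat A) (of_real x) \<Longrightarrow> x = \<rho>"
  shows "nonneg_recursion A"
proof -
  define B where "B = complex_mat A"
  have B: "B \<in> carrier_mat n n" using A by (simp add: B_def)
  have \<rho>: "0 < \<rho>" unfolding \<rho>_def by (rule irreducible_spectral_radius_pos[OF A nn irr \<open>n \<ge> 1\<close>])
  define cb where "cb = map_vec complex_of_real b"
  have cb: "cb \<in> carrier_vec n" using b by (simp add: cb_def)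
  have "krylov n B cb = complex_mat (krylov n A b)"
  proof (rule eq_matI)
    fix i j assume "i < dim_row (complex_mat (krylov n A b))" "j < dim_col (complex_mat (krylov n A b))"
    then have ij: "i < n" "j < n" by (auto simp: krylov_def)
    have "((B ^\<^sub>m j) *\<^sub>v cb) $ i = of_real (((A ^\<^sub>m j) *\<^sub>v b) $ i)"
      unfolding mult_mat_vec_index_sum[OF pow_carrier_mat[OF B] cb ij(1)]
        mult_mat_vec_index_sum[OF pow_carrier_mat[OF A] b ij(1)]
      using b ij unfolding B_def by (simp add: index_complex_mat_pow[OF A] cb_def)
    then show "krylov n B cb $$ (i, j) = complex_mat (krylov n A b) $$ (i, j)"
      using ij by (simp add: krylov_def)
  qed (auto simp: krylov_def)
  then have Kc: "det (krylov n B cb) \<noteq> 0" using K by (simp add: of_real_hom.hom_det)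
  obtain p where p: "lead_coeff p = 1" "degree p = n" "poly_mat B p = 0\<^sub>m n n"
    using ex_krylov_annihilator[OF B cb Kc] by blast
  have min: "q = 0" if "poly_mat B q = 0\<^sub>m n n" "degree q < n" for q
    by (rule krylov_annihilator_eq_0[OF B cb Kc that])
  have "p \<noteq> 0" using p(1) by auto
  have root_ev: "eigenvalue B l" if "poly p l = 0" for l
    by (rule eigenvalue_if_minimal_annihilator_root[OF B p(3) \<open>p \<noteq> 0\<close> _ that]) (use min p(2) in auto)
  have ev_root: "poly p l = 0" if ev: "eigenvalue B l" for l
  proof -
    obtain v where v: "v \<in> carrier_vec n" "v \<noteq> 0\<^sub>v n" "B *\<^sub>v v = l \<cdot>\<^sub>v v"
      using ev B unfolding eigenvalue_def eigenvector_def by auto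
    obtain k where k: "k < n" "v $ k \<noteq> 0" using v(1,2) by (metis carrier_vecD eq_vecI index_zero_vec)
    have "poly p l \<cdot>\<^sub>v v = 0\<^sub>m n n *\<^sub>v v"
      unfolding poly_mat_eigenvector[OF B v(1,3), symmetric] p(3) ..
    then have "(poly p l \<cdot>\<^sub>v v) $ k = 0" using v(1) k(1) by simp
    then show ?thesis using v(1) k by simp
  qed
  have ev_le: "cmod l \<le> \<rho>" if "eigenvalue B l" for l
    unfolding \<rho>_def B_def[symmetric] using that \<open>n \<ge> 1\<close>
    by (intro spectral_radius_mem_max(2)[OF B]) (auto simp: spectrum_def)
  define H where "H = {z. cmod z = 1 \<and> eigenvalue B (z * of_real \<rho>)}"
  have rot: "z ^ (n - k) = 1" if z: "z \<in> H" and k: "coeff p k \<noteq> 0" for z k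
  proof -
    have z1: "cmod z = 1" "eigenvalue (complex_mat A) (z * of_real (spectral_radius (complex_mat A)))"
      using z by (auto simp: H_def B_def \<rho>_def)
    obtain d where d: "\<And>i. i < n \<Longrightarrow> d i \<noteq> 0"
      "\<And>i j. i < n \<Longrightarrow> j < n \<Longrightarrow> of_real (A $$ (i, j)) * d j = z * d i * of_real (A $$ (i, j))"
      using peripheral_eigenvalue_phases[OF A nn irr \<open>n \<ge> 1\<close> z1(2,1)] by blast
    have "z \<noteq> 0" using z1(1) by auto
    show ?thesis
      by (rule peripheral_eigenvalue_power_coeff[OF A \<open>n \<ge> 1\<close> p(3)[unfolded B_def] p(2) min[unfolded B_def] d \<open>z \<noteq> 0\<close> k])
  qed
  have p\<rho>: "poly p (of_real \<rho>) = 0" using ev_\<rho> by (intro ev_root) (simp add: B_def)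
  \<comment> \<open>A second nonzero coefficient exists, as \<open>x^n\<close> alone would not
    vanish at \<rho>. It supplies the positive exponent \<open>n - k0\<close> that sends all of
    \<open>H\<close> to 1, so the \<open>LEAST\<close> defining \<open>g\<close> is
    attained.\<close>
  obtain k0 where k0: "k0 < n" "coeff p k0 \<noteq> 0"
  proof (rule ccontr)
    assume "\<not> thesis"
    with that have "coeff p k = 0" if "k < n" for k using \<open>k < n\<close> by blast
    then have "poly p (of_real \<rho>) = of_real \<rho> ^ n"
      using p(1,2) by (simp add: poly_altdef lessThan_Suc_atMost[symmetric])
    then show False using p\<rho> \<rho> by simp
  qed
  define g where "g = (LEAST t. 0 < t \<and> (\<forall>z\<in>H. z ^ t = 1))"
  have "0 < n - k0 \<and> (\<forall>z\<in>H. z ^ (n - k0) = 1)" using rot k0 by auto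
  then have g: "0 < g" "\<And>z. z \<in> H \<Longrightarrow> z ^ g = 1"
    using LeastI[of "\<lambda>t. 0 < t \<and> (\<forall>z\<in>H. z ^ t = 1)"] unfolding g_def by blast+
  have g_dvd: "g dvd t" if "\<And>z. z \<in> H \<Longrightarrow> z ^ t = 1" for t
  proof (rule ccontr)
    assume "\<not> g dvd t"
    then have "0 < t mod g" by (auto simp: dvd_eq_mod_eq_0)
    moreover have "z ^ (t mod g) = 1" if "z \<in> H" for z
    proof -
      have "z ^ t = (z ^ g) ^ (t div g) * z ^ (t mod g)"
        unfolding power_mult[symmetric] power_add[symmetric] by simp
      then show ?thesis using g(2)[OF that] \<open>z \<in> H \<Longrightarrow> z ^ t = 1\<close> that by simp
    qed
    ultimately have "g \<le> t mod g" unfolding g_def by (intro Least_le) auto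
    then show False using mod_less_divisor[OF g(1), of t] by linarith
  qed
  have "g dvd n - k" if "coeff p k \<noteq> 0" for k using rot that by (intro g_dvd) auto
  then obtain P where P: "p = monom 1 (n mod g) * pcompose P (monom 1 g)"
    using poly_eq_monom_mult_pcompose[OF p(2) g(1)] by blast
  define a where "a = n mod g"
  have poly_p: "poly p x = x ^ a * poly P (x ^ g)" for x
    unfolding P a_def by (simp add: poly_monom poly_pcompose)
  define s where "s = \<rho> ^ g"
  have s: "0 < s" using \<rho> by (simp add: s_def)
  have Ps: "poly P (of_real s) = 0" using p\<rho> \<rho> unfolding poly_p by (simp add: s_def)
  have "P \<noteq> 0" using \<open>p \<noteq> 0\<close> P by auto
  \<comment> \<open>Roots at 0 are split off first, because \<open>R\<close> must not have any
    nonnegative real root.\<close>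
  obtain k q where q: "P = [:- 0, 1:] ^ k * q" "\<not> [:- 0, 1:] dvd q"
    using order_decomp[OF \<open>P \<noteq> 0\<close>, of 0] by blast
  have q0: "poly q 0 \<noteq> 0" using q(2) by (simp add: poly_eq_0_iff_dvd)
  have "poly q (of_real s) = 0" using Ps s unfolding q(1) by simp
  then obtain R where R: "q = [:- of_real s, 1:] * R" by (auto simp: poly_eq_0_iff_dvd)
  \<comment> \<open>A second factor \<open>y - s\<close> of \<open>P\<close> would make
    \<open>p = L * L * w\<close> with \<open>L = x - \<rho>\<close>. Then \<open>(L w)(B)\<close> is
    nonzero by its degree, lies in the range of \<open>B - \<rho>\<close> as
    \<open>L(B) w(B)\<close>, and is killed by \<open>B - \<rho>\<close>, against
    \<open>simple\<close>.\<close>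
  have Rs: "poly R (of_real s) \<noteq> 0"
  proof
    assume "poly R (of_real s) = 0"
    then obtain R' where R': "R = [:- of_real s, 1:] * R'" by (auto simp: poly_eq_0_iff_dvd)
    define L where "L = [:- of_real \<rho>, 1 :: complex:]"
    have "poly (pcompose [:- of_real s, 1:] (monom 1 g)) (of_real \<rho>) = (0 :: complex)"
      by (simp add: poly_pcompose poly_monom s_def)
    then have "L dvd pcompose [:- of_real s, 1:] (monom 1 g)" unfolding L_def by (simp only: poly_eq_0_iff_dvd)
    then have "L * L dvd pcompose [:- of_real s, 1:] (monom 1 g) * pcompose [:- of_real s, 1:] (monom 1 g)"
      by (rule mult_dvd_mono) fact
    also have "\<dots> dvd p"
      unfolding P q(1) R R' pcompose_mult by (intro dvdI[of _ _ "monom 1 (n mod g) * (pcompose ([:- 0, 1:] ^ k) (monom 1 g) * pcompose R' (monom 1 g))"]) (simp only: mult_ac)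
    finally obtain w where w: "p = L * L * w" by (rule dvdE)
    have "L * w \<noteq> 0" using \<open>p \<noteq> 0\<close> w by auto
    have "degree p = Suc (degree (L * w))"
      unfolding w mult.assoc using \<open>L * w \<noteq> 0\<close> by (subst degree_mult_eq) (auto simp: L_def)
    then have "poly_mat B (L * w) \<noteq> 0\<^sub>m n n" using min[of "L * w"] \<open>L * w \<noteq> 0\<close> p(2) by auto
    moreover have "poly_mat B (L * w) = 0\<^sub>m n n"
    proof (rule simple[folded B_def])
      show "poly_mat B (L * w) = B * poly_mat B w + (- of_real \<rho>) \<cdot>\<^sub>m poly_mat B w"
        unfolding L_def by (rule poly_mat_linear_factor[OF B])
      have z: "B * poly_mat B (L * w) + (- of_real \<rho>) \<cdot>\<^sub>m poly_mat B (L * w) = 0\<^sub>m n n"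
        using p(3) unfolding w mult.assoc using poly_mat_linear_factor[OF B, of "of_real \<rho>" "L * w", folded L_def] by simp
      show "B * poly_mat B (L * w) = of_real \<rho> \<cdot>\<^sub>m poly_mat B (L * w)"
      proof (rule eq_matI)
        fix i j assume "i < dim_row (of_real \<rho> \<cdot>\<^sub>m poly_mat B (L * w))" "j < dim_col (of_real \<rho> \<cdot>\<^sub>m poly_mat B (L * w))"
        then have ij: "i < n" "j < n" using B by auto
        have "(B * poly_mat B (L * w) + (- of_real \<rho>) \<cdot>\<^sub>m poly_mat B (L * w)) $$ (i, j) = 0" unfolding z using ij by simp
        then show "(B * poly_mat B (L * w)) $$ (i, j) = (of_real \<rho> \<cdot>\<^sub>m poly_mat B (L * w)) $$ (i, j)"
          using ij B by simp
      qed (use B in auto)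
    qed (use B in auto)
    ultimately show False by simp
  qed
  have roots: "cmod c < s \<and> c \<notin> \<real>\<^sub>\<ge>\<^sub>0" if Rc: "poly R c = 0" for c
  proof -
    have "poly q c = 0" unfolding R using Rc by simp
    then have c0: "c \<noteq> 0" and Pc: "poly P c = 0" using q0 by (auto simp: q(1))
    have cs: "c \<noteq> of_real s" using Rc Rs by auto
    \<comment> \<open>Any \<open>g\<close>-th root of \<open>c\<close> is an eigenvalue. If its
      modulus were \<rho>, then \<open>l / \<rho>\<close> would belong to \<open>H\<close>, whose
      elements have \<open>g\<close>-th power 1, and \<open>c\<close> would equal
      \<open>s\<close>.\<close>
    obtain l where l: "l ^ g = c" using ex_complex_root[OF g(1)] by blast
    have ev: "eigenvalue B l" by (rule root_ev) (simp add: poly_p l Pc)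
    have c_le: "cmod c \<le> s" unfolding l[symmetric] s_def norm_power using ev_le[OF ev] by (intro power_mono) auto
    moreover have "cmod c \<noteq> s"
    proof
      assume "cmod c = s"
      then have "cmod l ^ g = \<rho> ^ g" by (simp add: l[symmetric] s_def norm_power)
      then have "cmod l = \<rho>" using g(1) \<rho> by (intro power_eq_imp_eq_base[of "cmod l" g \<rho>]) auto
      then have "l / of_real \<rho> \<in> H" using \<rho> ev by (simp add: H_def norm_divide)
      then have "(l / of_real \<rho>) ^ g = 1" by (rule g(2))
      then have "c = of_real s" using \<rho> by (simp add: power_divide l s_def)
      with cs show False by simp
    qed
    moreover have "c \<notin> \<real>\<^sub>\<ge>\<^sub>0"
    proof
      assume "c \<in> \<real>\<^sub>\<ge>\<^sub>0"
      then obtain t where t: "c = of_real t" "0 \<le> t" by (auto simp: nonneg_Reals_def)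
      then have t0: "0 < t" using c0 by auto
      \<comment> \<open>The positive \<open>g\<close>-th root of a positive \<open>c\<close> would
        be a positive eigenvalue, hence \<rho>, and again \<open>c = s\<close>.\<close>
      define u where "u = root g t"
      have u: "0 < u" "u ^ g = t" using t0 g(1) by (auto simp: u_def)
      have "poly p (of_real u) = 0" unfolding poly_p of_real_power[symmetric] u(2) t(1)[symmetric] Pc by simp
      then have "eigenvalue (complex_mat A) (of_real u)" using root_ev by (simp add: B_def)
      then have "u = \<rho>" using nopos u(1) by blast
      then have "c = of_real s" using u(2) t(1) by (simp add: s_def)
      with cs show False by simp
    qed
    ultimately show ?thesis by simp
  qed
  have "R \<noteq> 0" using Rs by auto
  obtain m f where f: "degree f < m" "\<And>i. 0 \<le> Re (coeff f i)" "[:- of_real s, 1:] * R dvd monom 1 m - f"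
    using dominant_root_poly_dvd_nonneg_recursion[OF \<open>R \<noteq> 0\<close> s roots] by blast
  \<comment> \<open>Substituting \<open>y = x^g\<close> and restoring the factor
    \<open>x^a * y^k\<close> sends \<open>y^i\<close> to \<open>x^(a + g * (k + i))\<close>;
    nonnegativity of coefficients survives this.\<close>
  define M where "M = a + g * (k + m)"
  define F2 where "F2 = (\<Sum>i<m. monom (coeff f i) (a + g * (k + i)))"
  define F where "F = monom 1 M - F2"
  have "P dvd [:- 0, 1:] ^ k * (monom 1 m - f)"
    unfolding q(1) R using f(3) by (intro mult_dvd_mono) auto
  then obtain w where w: "[:- 0, 1:] ^ k * (monom 1 m - f) = P * w" by (rule dvdE)
  have "F = p * pcompose w (monom 1 g)"
  proof -
    have "poly F x = poly (p * pcompose w (monom 1 g)) x" for x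
    proof -
      have "poly (p * pcompose w (monom 1 g)) x = x ^ a * poly (P * w) (x ^ g)"
        by (simp add: poly_p poly_pcompose poly_monom)
      also have "\<dots> = x ^ a * ((x ^ g) ^ k * ((x ^ g) ^ m - poly f (x ^ g)))"
        unfolding w[symmetric] by (simp add: poly_monom)
      also have "poly f (x ^ g) = (\<Sum>i<m. coeff f i * (x ^ g) ^ i)"
        unfolding poly_altdef using f(1) by (intro sum.mono_neutral_left) (auto simp: coeff_eq_0)
      also have "x ^ a * ((x ^ g) ^ k * ((x ^ g) ^ m - (\<Sum>i<m. coeff f i * (x ^ g) ^ i))) = poly F x"
        by (simp add: F_def F2_def M_def poly_monom poly_sum right_diff_distrib sum_distrib_left
            power_add power_mult[symmetric] distrib_left mult_ac)
      finally show ?thesis by simp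
    qed
    then show ?thesis by (simp add: poly_eq_poly_eq_iff[symmetric] fun_eq_iff)
  qed
  then have F0: "poly_mat B F = 0\<^sub>m n n" using poly_mat_dvd_eq_0[OF B p(3)] by simp
  have coeff_F2: "coeff F2 i = (\<Sum>l<m. if a + g * (k + l) = i then coeff f l else 0)" for i
    by (simp add: F2_def coeff_sum)
  have F2_high: "coeff F2 i = 0" if "M \<le> i" for i
    unfolding coeff_F2
  proof (intro sum.neutral ballI)
    fix l assume "l \<in> {..<m}"
    then have "g * (k + l) < g * (k + m)" using g(1) by simp
    then have "a + g * (k + l) < M" by (simp only: M_def add_less_cancel_left)
    then show "(if a + g * (k + l) = i then coeff f l else 0) = 0" using that by simp
  qed
  have F2_nonneg: "0 \<le> Re (coeff F2 i)" for i
    unfolding coeff_F2 Re_sum by (intro sum_nonneg) (auto simp: f(2))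
  have degF: "degree F \<le> M" by (rule degree_le) (auto simp: F_def F2_high)
  have "(A ^\<^sub>m M) $$ (i, j) = (\<Sum>l<M. Re (coeff F2 l) * (A ^\<^sub>m l) $$ (i, j))" if ij: "i < n" "j < n" for i j
  proof -
    have "0 = (\<Sum>l\<le>M. coeff F l * of_real ((A ^\<^sub>m l) $$ (i, j)))"
      using index_poly_mat[OF B ij degF] ij by (simp add: F0[unfolded B_def] B_def index_complex_mat_pow[OF A ij])
    also have "\<dots> = of_real ((A ^\<^sub>m M) $$ (i, j)) - (\<Sum>l<M. coeff F2 l * of_real ((A ^\<^sub>m l) $$ (i, j)))"
      by (simp add: lessThan_Suc_atMost[symmetric] F_def F2_high sum_negf)
    finally have "Re (of_real ((A ^\<^sub>m M) $$ (i, j))) = Re (\<Sum>l<M. coeff F2 l * of_real ((A ^\<^sub>m l) $$ (i, j)))" by simp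
    then show ?thesis by simp
  qed
  with F2_nonneg show ?thesis
    unfolding nonneg_recursion_iff[OF A \<open>n \<ge> 1\<close>]
    by (intro exI[of _ M] exI[of _ "\<lambda>l. Re (coeff F2 l)"]) simp
qed

theorem theorem3:
  fixes n :: nat and A A2 S Sinv :: "real mat" and b :: "real vec" and A1 :: real
  assumes "n \<ge> 1"
    and "A \<in> carrier_mat n n" and "nonneg_mat A" and "irreducible_mat A"
    and "b \<in> carrier_vec n" and "nonneg_vec b"
    and "vec_space.rank n (krylov_mat A b) = n"
    and "S \<in> carrier_mat n n" and "Sinv \<in> carrier_mat n n"
    and "S * Sinv = 1\<^sub>m n" and "Sinv * S = 1\<^sub>m n"
    and "A2 \<in> carrier_mat (n - 1) (n - 1)"
    and "A = S * diag_block_mat [mat 1 1 (\<lambda>_. A1), A2] * Sinv"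
    and "A1 = spectral_radius (complex_mat A)"
    and "spectrum (complex_mat A2) =
           spectrum (complex_mat A) - {complex_of_real (spectral_radius (complex_mat A))}"
  shows "(polyhedral_cone n (conset_fin A b) \<longleftrightarrow> nonneg_recursion A) \<and>
         (nonneg_recursion A \<longleftrightarrow>
            \<not> (\<exists>x::real. x > 0 \<and> complex_of_real x \<in> spectrum (complex_mat A2))) \<and>
         (polyhedral_cone n (conset_fin A b) \<longrightarrow>
            (\<exists>k\<ge>1. k \<ge> vertex_number A b \<and> conset_fin A b = conset k A b))"
proof -
  note A = assms(2) and b = assms(5) and spec = assms(15)
  define \<rho> where "\<rho> = spectral_radius (complex_mat A)"
  obtain m where n: "n = Suc m" using assms(1) by (cases n) auto
  have nn: "0 \<le> A $$ (i, j)" if "i < n" "j < n" for i j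
    using assms(3) A that by (auto simp: nonneg_mat_def)
  have "krylov_mat A b = krylov n A b"
    unfolding krylov_mat_def krylov_def using b
    by (intro eq_matI) (auto simp: mat_of_cols_index)
  then have K: "det (krylov n A b) \<noteq> 0"
    using assms(7) vec_space.det_rank_iff[OF krylov_carrier, of n A b] by simp
  define D where "D = diag_block_mat [mat 1 1 (\<lambda>_. A1), A2]"
  have A2: "A2 \<in> carrier_mat m m" using assms(12) n by simp
  have D: "D \<in> carrier_mat (Suc m) (Suc m)" "D $$ (0, 0) = \<rho>"
    "\<And>j. j < m \<Longrightarrow> D $$ (0, Suc j) = 0" "\<And>i. i < m \<Longrightarrow> D $$ (Suc i, 0) = 0"
    "\<And>i j. i < m \<Longrightarrow> j < m \<Longrightarrow> D $$ (Suc i, Suc j) = A2 $$ (i, j)"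
    using A2 assms(14) by (auto simp: D_def \<rho>_def Let_def)
  note S = assms(8)[unfolded n] and Si = assms(9)[unfolded n]
  \<comment> \<open>The real decomposition is transported to the complex numbers, where the spectra
    are defined.\<close>
  define T Ti cD where "T = complex_mat S" and "Ti = complex_mat Sinv" and "cD = complex_mat D"
  have c: "complex_mat A \<in> carrier_mat (Suc m) (Suc m)" "T \<in> carrier_mat (Suc m) (Suc m)"
    "Ti \<in> carrier_mat (Suc m) (Suc m)" "cD \<in> carrier_mat (Suc m) (Suc m)" "complex_mat A2 \<in> carrier_mat m m"
    using A S Si D(1) A2 n by (auto simp: T_def Ti_def cD_def)
  have inv: "T * Ti = 1\<^sub>m (Suc m)" "Ti * T = 1\<^sub>m (Suc m)"
    unfolding T_def Ti_def of_real_hom.mat_hom_mult[OF S Si, symmetric] of_real_hom.mat_hom_mult[OF Si S, symmetric]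
    using assms(10,11) n by (auto simp: of_real_hom.mat_hom_one)
  have dec: "complex_mat A = T * cD * Ti"
    unfolding T_def Ti_def cD_def of_real_hom.mat_hom_mult[OF S D(1), symmetric]
      of_real_hom.mat_hom_mult[OF mult_carrier_mat[OF S D(1)] Si, symmetric]
    using assms(13) by (simp add: D_def)
  have cD: "cD $$ (0, 0) = of_real \<rho>" "\<And>j. j < m \<Longrightarrow> cD $$ (0, Suc j) = 0" "\<And>i. i < m \<Longrightarrow> cD $$ (Suc i, 0) = 0"
    "\<And>i j. i < m \<Longrightarrow> j < m \<Longrightarrow> cD $$ (Suc i, Suc j) = complex_mat A2 $$ (i, j)"
    using D A2 by (auto simp: cD_def)
  have ev_\<rho>: "eigenvalue (complex_mat A) (of_real \<rho>)"
    by (rule block_diag_eigenvalue[OF c(2,3,4) inv(2) dec cD(1,3)])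
  \<comment> \<open>The set difference in the spectral hypothesis enters here: it supplies
    simplicity of \<rho> through the block form.\<close>
  have "\<not> eigenvalue (complex_mat A2) (of_real \<rho>)" using spec by (auto simp: spectrum_def \<rho>_def)
  note simple = block_diag_eigenvector_not_in_range[OF c inv dec cD this]
  have "nonneg_recursion A \<longleftrightarrow> \<not> (\<exists>x::real. x > 0 \<and> complex_of_real x \<in> spectrum (complex_mat A2))"
  proof
    assume rec: "nonneg_recursion A"
    show "\<not> (\<exists>x::real. x > 0 \<and> complex_of_real x \<in> spectrum (complex_mat A2))"
    proof
      assume "\<exists>x::real. x > 0 \<and> complex_of_real x \<in> spectrum (complex_mat A2)"
      then obtain x :: real where x: "x > 0" "eigenvalue (complex_mat A) (of_real x)" "x \<noteq> \<rho>"
        using spec by (auto simp: spectrum_def \<rho>_def)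
      have "cmod (of_real x) \<in> cmod ` spectrum (complex_mat A)"
        using x(2) by (intro imageI) (simp add: spectrum_def)
      then have "cmod (of_real x) \<le> \<rho>"
        unfolding \<rho>_def using n by (intro spectral_radius_mem_max(2)[OF c(1)]) auto
      then have "x < \<rho>" using x(1,3) by simp
      then show False
        using nonneg_recursion_positive_eigenvalue_unique[OF A assms(1) rec x(1,2) ev_\<rho>] by simp
    qed
  next
    assume "\<not> (\<exists>x::real. x > 0 \<and> complex_of_real x \<in> spectrum (complex_mat A2))"
    then have "x = \<rho>" if "0 < x" "eigenvalue (complex_mat A) (of_real x)" for x
      using that spec by (auto simp: spectrum_def \<rho>_def)
    then show "nonneg_recursion A"
      using simple ev_\<rho> n unfolding \<rho>_def
      by (intro nonneg_recursion_if_no_other_positive_eigenvalue[OF A nn assms(4,1) b K]) auto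
  qed
  then show ?thesis
    using nonneg_recursion_iff_polyhedral_cone[OF A b assms(1) K] by blast
qed

end
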